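(* Let $x_1,\dots,x_n\in\mathbb{R}^d$ and $X=\mathrm{conv}\{\pm x_1,\dots,\pm x_n\}$. Let $r>0$ be such that $r\cdot B_2^d\subseteq X$ and let $R=\max_t\|x_t\|$. Let $\mathcal{E}_n$ be the output of the scale-dependent streaming algorithm described in the context, run on $x_1,\dots,x_n$ with parameter $r$. Then there is $\alpha=O\big(\sqrt{d\log(R/r+1)}\big)$ (with an absolute constant in the $O$) such that $$\frac{\mathcal{E}_n}{\alpha}\subseteq X\subseteq \mathcal{E}_n .$$
   Context: $B_2^d$ denotes the Euclidean unit ball in $\mathbb{R}^d$; all ellipsoids are centered at the origin. Scale-dependent algorithm: it receives the points $x_1,\dots,x_n$ one at a time and the value $r$. It initializes $\mathcal{E}_0=r\cdot B_2^d$, and for $t=1,\dots,n$, upon reading $x_t$, it sets $\mathcal{E}_t$ to be the origin-centered ellipsoid of smallest volume that contains both $\mathcal{E}_{t-1}$ and $x_t$. It outputs $\mathcal{E}_n$. *)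

theory Defs
  imports "HOL-Analysis.Lebesgue_Measure" "Jordan_Normal_Form.Matrix"
begin

text \<open>The constant in the main bound is absolute, so the dimension \<open>d\<close> has to be quantified
  inside the statement and cannot be a type.  Hence \<open>\<real>\<^sup>d\<close> is \<^term>\<open>carrier_vec d :: real Matrix.vec set\<close>.\<close>

definition vec_len :: "real Matrix.vec \<Rightarrow> real" where
  "vec_len v = sqrt (scalar_prod v v)"

definition centered_ball :: "nat \<Rightarrow> real \<Rightarrow> real Matrix.vec set" where
  "centered_ball d r = {v \<in> carrier_vec d. vec_len v \<le> r}"

text \<open>Lebesgue measure on \<open>\<real>\<^sup>d\<close> is the \<open>d\<close>-fold product of \<^term>\<open>lborel\<close>, which lives on extensional
  functions on \<open>{..<d}\<close>; sets of vectors are transported to it by reading off coordinates.\<close>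

definition volume :: "nat \<Rightarrow> real Matrix.vec set \<Rightarrow> ennreal" where
  "volume d S = emeasure (\<Pi>\<^sub>M i\<in>{..<d}. (lborel :: real measure))
                  {f \<in> {..<d} \<rightarrow>\<^sub>E UNIV. Matrix.vec d f \<in> S}"

definition convex_hull_vec :: "nat \<Rightarrow> real Matrix.vec set \<Rightarrow> real Matrix.vec set" where
  "convex_hull_vec d S =
     {v. \<exists>T c. finite T \<and> T \<subseteq> S \<and> (\<forall>w\<in>T. 0 \<le> c w) \<and> (\<Sum>w\<in>T. c w) = 1 \<and>
            v = Matrix.vec d (\<lambda>i. \<Sum>w\<in>T. c w * vec_index w i)}"

definition is_ellipsoid :: "nat \<Rightarrow> real Matrix.vec set \<Rightarrow> bool" where
  "is_ellipsoid d E \<longleftrightarrow>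
     (\<exists>A \<in> carrier_mat d d. invertible_mat A \<and> E = (\<lambda>u. A *\<^sub>v u) ` centered_ball d 1)"

definition is_min_ellipsoid :: "nat \<Rightarrow> real Matrix.vec set \<Rightarrow> real Matrix.vec set \<Rightarrow> bool" where
  "is_min_ellipsoid d S E \<longleftrightarrow>
     is_ellipsoid d E \<and> S \<subseteq> E \<and> (\<forall>F. is_ellipsoid d F \<and> S \<subseteq> F \<longrightarrow> volume d E \<le> volume d F)"

definition min_ellipsoid :: "nat \<Rightarrow> real Matrix.vec set \<Rightarrow> real Matrix.vec set" where
  "min_ellipsoid d S = (THE E. is_min_ellipsoid d S E)"

text \<open>The state \<open>\<E>\<^sub>t\<close> after reading the points \<open>x 1, \<dots>, x t\<close>.\<close>

primrec stream_ellipsoid :: "nat \<Rightarrow> real \<Rightarrow> (nat \<Rightarrow> real Matrix.vec) \<Rightarrow> nat \<Rightarrow> real Matrix.vec set" where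
  "stream_ellipsoid d r x 0 = centered_ball d r"
| "stream_ellipsoid d r x (Suc t) = min_ellipsoid d (insert (x (Suc t)) (stream_ellipsoid d r x t))"

definition symmetric_hull :: "nat \<Rightarrow> (nat \<Rightarrow> real Matrix.vec) \<Rightarrow> nat \<Rightarrow> real Matrix.vec set" where
  "symmetric_hull d x n = convex_hull_vec d (\<Union>t\<in>{1..n}. {x t, - x t})"

end

theory Submission
  imports Defs "Jordan_Normal_Form.Determinant"
begin

text \<open>Write an ellipsoid as \<open>A B\<close> with \<open>B\<close> the unit ball; it is determined by \<open>A A\<^sup>T\<close>. Reading
  a point \<open>x\<^sub>t\<close> changes \<open>A A\<^sup>T\<close> by a rank-one term \<open>c\<^sub>t x\<^sub>t x\<^sub>t\<^sup>T\<close> with \<open>c\<^sub>t \<ge> 0\<close>, where \<open>c\<^sub>t\<close> is at most the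
  increase of \<open>ln (det A)\<^sup>2\<close>. Hence at the end \<open>A A\<^sup>T = r\<^sup>2 I + \<Sum> c\<^sub>t x\<^sub>t x\<^sub>t\<^sup>T\<close>, and every point of the ellipsoid is,
  up to the factor \<open>sqrt (1 + \<Sum> c\<^sub>t)\<close>, a combination of the \<open>x\<^sub>t\<close> and of a point of the ball of radius
  \<open>r\<close>. The potential \<open>ln (det A)\<^sup>2\<close> is bounded through the trace of \<open>A A\<^sup>T\<close>, which itself is at most
  \<open>d r\<^sup>2 + R\<^sup>2 \<Sum> c\<^sub>t\<close>; scaling this AM-GM bound so that the last term is absorbed leaves
  \<open>\<Sum> c\<^sub>t = O(d ln (R/r + 1))\<close>.\<close>

text \<open>The update of the algorithm is a definite description, so nothing is known about it
  until a unique ellipsoid of least volume is exhibited. An explicit candidate \<open>M'\<close> is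
  tested against every competitor \<open>M\<close> with inverse \<open>N\<close>: if
  \<open>fro (N * M') \<le> d\<close>, AM-GM bounds the ratio of the determinants by 1, and the
  equality case makes \<open>N * M'\<close> orthogonal, so that both ellipsoids agree. Existence and
  uniqueness come from this one inequality, without compactness. Volumes must be compared in a
  dimension that is a variable. Cholesky factors serve twice: they reduce AM-GM to the diagonal
  entries, and they reduce the change of variables to one-dimensional affine substitutions. If a
  point forces a stretch by the factor \<rho>, its coefficient is 1 - 1/\<rho>^2 while the potential
  grows by ln \<rho>^2; the elementary bound ln t >= 1 - 1/t links the two.\<close>

unbundle no inner_syntax and no vec_syntax

section \<open>Squared Frobenius norm and rank-one stretches of the identity\<close>

abbreviation ell :: "nat \<Rightarrow> real mat \<Rightarrow> real Matrix.vec set" where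
  "ell d A \<equiv> (\<lambda>u. A *\<^sub>v u) ` centered_ball d 1"

text \<open>The square of the Frobenius norm. For square \<open>A\<close> it is the trace of
  \<open>A * A\<^sup>T\<close>, and it is additive over columns; both readings are used.\<close>

definition fro :: "real mat \<Rightarrow> real" where
  "fro A = (\<Sum>i\<in>{0..<dim_row A}. \<Sum>j\<in>{0..<dim_col A}. (A $$ (i,j))\<^sup>2)"

text \<open>The matrix I + a u u^T. For a unit vector \<open>u\<close> it multiplies the direction
  \<open>u\<close> by 1 + a and fixes the orthogonal complement; \<open>a = -1\<close> is the
  projection onto that complement.\<close>

definition stretch :: "nat \<Rightarrow> real Matrix.vec \<Rightarrow> real \<Rightarrow> real mat" where
  "stretch d u a = Matrix.mat d d (\<lambda>(i,j). (if i = j then 1 else 0) + a * u $ i * u $ j)"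

lemma scalar_prod_self_nonneg: "0 \<le> (v :: real Matrix.vec) \<bullet> v"
  unfolding scalar_prod_def by (rule sum_nonneg) simp

lemma scalar_prod_self_eq: "(v :: real Matrix.vec) \<bullet> v = (\<Sum>i\<in>{0..<dim_vec v}. (v $ i)\<^sup>2)"
  unfolding scalar_prod_def by (simp add: power2_eq_square)

lemma mem_unit_ball: "v \<in> centered_ball d 1 \<longleftrightarrow> v \<in> carrier_vec d \<and> v \<bullet> v \<le> 1"
  unfolding centered_ball_def vec_len_def by simp

lemma scalar_prod_self_pos:
  assumes "(v :: real Matrix.vec) \<in> carrier_vec d" "v \<noteq> 0\<^sub>v d"
  shows "0 < v \<bullet> v"
proof -
  obtain i where i: "i < d" "v $ i \<noteq> 0"
    using assms by (metis carrier_vecD eq_vecI index_zero_vec)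
  have "0 < (\<Sum>i\<in>{0..<dim_vec v}. (v $ i)\<^sup>2)"
    by (rule sum_pos2[of _ i]) (use assms i in auto)
  then show ?thesis by (simp add: scalar_prod_self_eq)
qed

lemma scalar_prod_add_smult_self:
  assumes "v \<in> carrier_vec d" "u \<in> carrier_vec d"
  shows "(v + a \<cdot>\<^sub>v u) \<bullet> (v + a \<cdot>\<^sub>v u) = v \<bullet> v + 2 * a * (v \<bullet> u) + a\<^sup>2 * (u \<bullet> (u :: real Matrix.vec))"
  using assms
  by (simp add: add_scalar_prod_distrib[of _ d] scalar_prod_add_distrib[of _ d]
      comm_scalar_prod[of u d v] power2_eq_square algebra_simps)

lemma scalar_prod_transpose:
  assumes "A \<in> carrier_mat n m" "u \<in> carrier_vec m" "v \<in> carrier_vec n"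
  shows "(A *\<^sub>v u) \<bullet> v = u \<bullet> (A\<^sup>T *\<^sub>v (v :: real Matrix.vec))"
  using transpose_vec_mult_scalar[OF assms] comm_scalar_prod assms
  by (metis mult_mat_vec_carrier transpose_carrier_mat)

lemma fro_cols: "fro A = (\<Sum>j\<in>{0..<dim_col A}. col A j \<bullet> col A j)"
  unfolding fro_def by (subst sum.swap) (simp add: scalar_prod_self_eq)

lemma fro_gram: "A \<in> carrier_mat d d \<Longrightarrow> fro A = (\<Sum>i\<in>{0..<d}. (A * A\<^sup>T) $$ (i,i))"
  unfolding fro_def by (simp add: scalar_prod_def power2_eq_square)

lemma fro_one: "fro (1\<^sub>m d) = d"
proof -
  have "fro (1\<^sub>m d) = (\<Sum>i\<in>{0..<d}. 1)"
    unfolding fro_def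
    by (rule sum.cong) (auto simp: if_distrib[of "\<lambda>x. x\<^sup>2"] cong: if_cong)
  then show ?thesis by simp
qed

text \<open>The columns of \<open>V * P\<close> are the images under \<open>V\<close> of the columns
  of \<open>P\<close>, so no squared column length grows.\<close>

lemma fro_contraction:
  assumes V: "V \<in> carrier_mat d d" and P: "P \<in> carrier_mat d d"
    and contr: "\<And>x. x \<in> carrier_vec d \<Longrightarrow> (V *\<^sub>v x) \<bullet> (V *\<^sub>v x) \<le> x \<bullet> x"
  shows "fro (V * P) \<le> fro P"
proof -
  have "col (V * P) j \<bullet> col (V * P) j \<le> col P j \<bullet> col P j" if "j < d" for j
    using that col_mult2[OF V P that] contr[of "col P j"] P by simp
  then show ?thesis
    unfolding fro_cols using V P by (auto intro: sum_mono)
qed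

lemma stretch_carrier[simp]: "stretch d u a \<in> carrier_mat d d"
  unfolding stretch_def by simp

lemma stretch_mult_vec:
  assumes "u \<in> carrier_vec d" "x \<in> carrier_vec d"
  shows "stretch d u a *\<^sub>v x = x + (a * (x \<bullet> u)) \<cdot>\<^sub>v u"
proof (rule eq_vecI)
  fix i assume "i < dim_vec (x + (a * (x \<bullet> u)) \<cdot>\<^sub>v u)"
  then have i: "i < d" using assms by simp
  have "(stretch d u a *\<^sub>v x) $ i = (\<Sum>j = 0..<d. ((if i = j then 1 else 0) + a * u $ i * u $ j) * x $ j)"
    using i assms by (simp add: stretch_def scalar_prod_def)
  also have "\<dots> = (\<Sum>j = 0..<d. (if i = j then x $ j else 0) + a * u $ i * (x $ j * u $ j))"
    by (rule sum.cong) (auto simp: algebra_simps)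
  also have "\<dots> = x $ i + a * u $ i * (x \<bullet> u)"
    using i assms by (simp add: sum.distrib sum_distrib_left[symmetric] scalar_prod_def)
  finally show "(stretch d u a *\<^sub>v x) $ i = (x + (a * (x \<bullet> u)) \<cdot>\<^sub>v u) $ i"
    using i assms by simp
qed (use assms in \<open>simp add: stretch_def\<close>)

lemma stretch_transpose: "(stretch d u a)\<^sup>T = stretch d u a"
  unfolding stretch_def by (rule eq_matI) auto

lemma stretch_mult_right:
  assumes V: "V \<in> carrier_mat d d" and u: "u \<in> carrier_vec d" and ij: "i < d" "j < d"
  shows "(V * stretch d u a) $$ (i,j) = V $$ (i,j) + a * (V *\<^sub>v u) $ i * u $ j"
proof -
  have "(V * stretch d u a) $$ (i,j)
      = (\<Sum>k = 0..<d. V $$ (i,k) * ((if k = j then 1 else 0) + a * u $ k * u $ j))"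
    using V ij by (simp add: stretch_def scalar_prod_def)
  also have "\<dots> = (\<Sum>k = 0..<d. (if k = j then V $$ (i,k) else 0) + a * u $ j * (V $$ (i,k) * u $ k))"
    by (rule sum.cong) (auto simp: algebra_simps)
  also have "\<dots> = V $$ (i,j) + a * u $ j * (V *\<^sub>v u) $ i"
    using ij V u by (simp add: sum.distrib sum_distrib_left[symmetric] scalar_prod_def)
  finally show ?thesis by (simp add: algebra_simps)
qed

text \<open>The factors along \<open>u\<close> multiply: (1 + a)(1 + b) = 1 + (a + b + ab).\<close>

lemma stretch_mult_stretch:
  assumes u: "u \<in> carrier_vec d" "u \<bullet> u = 1"
  shows "stretch d u a * stretch d u b = stretch d u (a + b + a * b)"
proof (rule eq_matI)
  fix i j assume "i < dim_row (stretch d u (a + b + a * b))" "j < dim_col (stretch d u (a + b + a * b))"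
  then have ij: "i < d" "j < d" by (auto simp: stretch_def)
  show "(stretch d u a * stretch d u b) $$ (i,j) = stretch d u (a + b + a * b) $$ (i,j)"
    unfolding stretch_mult_right[OF stretch_carrier u(1) ij] stretch_mult_vec[OF u(1) u(1)]
    using ij u by (simp add: stretch_def algebra_simps)
qed (simp_all add: stretch_def)

lemma stretch_zero: "stretch d u 0 = 1\<^sub>m d"
  unfolding stretch_def by (rule eq_matI) auto

text \<open>In an orthonormal basis containing \<open>u\<close>, only the image of \<open>u\<close>
  changes, by the factor 1 + a; the increment is ((1 + a)^2 - 1) |V u|^2. The computation below does
  this row by row without choosing a basis.\<close>

lemma fro_mult_stretch:
  assumes V: "V \<in> carrier_mat d d" and u: "u \<in> carrier_vec d" "u \<bullet> u = 1"
  shows "fro (V * stretch d u a) = fro V + (2 * a + a\<^sup>2) * ((V *\<^sub>v u) \<bullet> (V *\<^sub>v u))"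
proof -
  let ?w = "V *\<^sub>v u"
  have wi: "?w $ i = (\<Sum>j = 0..<d. V $$ (i,j) * u $ j)" if "i < d" for i
    using that V u by (simp add: scalar_prod_def)
  have uu: "(\<Sum>j = 0..<d. (u $ j)\<^sup>2) = 1" using u by (simp add: scalar_prod_self_eq)
  have row: "(\<Sum>j = 0..<d. (V $$ (i,j) + a * ?w $ i * u $ j)\<^sup>2)
      = (\<Sum>j = 0..<d. (V $$ (i,j))\<^sup>2) + (2 * a + a\<^sup>2) * (?w $ i)\<^sup>2" if "i < d" for i
  proof -
    have "(\<Sum>j = 0..<d. (V $$ (i,j) + a * ?w $ i * u $ j)\<^sup>2)
      = (\<Sum>j = 0..<d. (V $$ (i,j))\<^sup>2 + 2 * a * ?w $ i * (V $$ (i,j) * u $ j) + (a * ?w $ i)\<^sup>2 * (u $ j)\<^sup>2)"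
      by (rule sum.cong) (auto simp: power2_eq_square algebra_simps)
    also have "\<dots> = (\<Sum>j = 0..<d. (V $$ (i,j))\<^sup>2) + 2 * a * ?w $ i * ?w $ i + (a * ?w $ i)\<^sup>2"
      by (simp add: sum.distrib sum_distrib_left[symmetric] uu wi[OF that])
    finally show ?thesis by (simp add: power2_eq_square algebra_simps)
  qed
  have "fro (V * stretch d u a) = (\<Sum>i = 0..<d. \<Sum>j = 0..<d. (V $$ (i,j) + a * ?w $ i * u $ j)\<^sup>2)"
    unfolding fro_def using V carrier_matD(2)[OF stretch_carrier[of d u a]]
    by (auto intro!: sum.cong simp: stretch_mult_right[OF V u(1)] simp del: index_mult_mat(1))
  also have "\<dots> = (\<Sum>i = 0..<d. (\<Sum>j = 0..<d. (V $$ (i,j))\<^sup>2) + (2 * a + a\<^sup>2) * (?w $ i)\<^sup>2)"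
    by (rule sum.cong) (use row in auto)
  also have "\<dots> = fro V + (2 * a + a\<^sup>2) * (?w \<bullet> ?w)"
    unfolding sum.distrib sum_distrib_left[symmetric] fro_def scalar_prod_self_eq using V by simp
  finally show ?thesis .
qed

lemma fro_stretch:
  assumes "u \<in> carrier_vec d" "u \<bullet> u = 1"
  shows "fro (stretch d u a) = d + (2 * a + a\<^sup>2)"
  using fro_mult_stretch[OF one_carrier_mat assms, of a] assms
  by (simp add: fro_one left_mult_one_mat[OF stretch_carrier])

section \<open>Inverses, and ellipsoids as images of the unit ball\<close>

lemma inverse_mat_exists:
  assumes "invertible_mat A" "(A :: real mat) \<in> carrier_mat d d"
  obtains B where "B \<in> carrier_mat d d" "A * B = 1\<^sub>m d" "B * A = 1\<^sub>m d"
proof -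
  obtain B where B: "A * B = 1\<^sub>m (dim_row A)" "B * A = 1\<^sub>m (dim_row B)"
    using assms(1) unfolding invertible_mat_def inverts_mat_def by auto
  have "dim_col B = d" using arg_cong[OF B(1), of dim_col] assms(2) by simp
  moreover have "dim_row B = d" using arg_cong[OF B(2), of dim_col] assms(2) by simp
  ultimately show thesis using B assms(2) that[of B] by auto
qed

lemma invertible_matI:
  assumes "A \<in> carrier_mat d d" "B \<in> carrier_mat d d" "A * B = 1\<^sub>m d"
  shows "invertible_mat (A :: real mat)"
  using assms mat_mult_left_right_inverse[OF assms]
  unfolding invertible_mat_def inverts_mat_def by auto

lemma mult_mat_vec_inverse:
  assumes "A \<in> carrier_mat d d" "B \<in> carrier_mat d d" "A * B = 1\<^sub>m d" "v \<in> carrier_vec d"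
  shows "A *\<^sub>v (B *\<^sub>v v) = (v :: real Matrix.vec)"
  using assms assoc_mult_mat_vec[of A d d B d v] by simp

lemma mem_ell_iff:
  assumes A: "A \<in> carrier_mat d d" and B: "B \<in> carrier_mat d d" and AB: "A * B = 1\<^sub>m d"
  shows "v \<in> ell d A \<longleftrightarrow> v \<in> carrier_vec d \<and> (B *\<^sub>v v) \<bullet> (B *\<^sub>v v) \<le> 1"
proof -
  note BA = mat_mult_left_right_inverse[OF A B AB]
  show ?thesis
  proof
    assume "v \<in> ell d A"
    then obtain u where u: "u \<in> carrier_vec d" "u \<bullet> u \<le> 1" and v: "v = A *\<^sub>v u"
      by (auto simp: mem_unit_ball)
    have "B *\<^sub>v v = u" unfolding v by (rule mult_mat_vec_inverse[OF B A BA u(1)])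
    moreover have "v \<in> carrier_vec d" unfolding v using A u(1) by (rule mult_mat_vec_carrier)
    ultimately show "v \<in> carrier_vec d \<and> (B *\<^sub>v v) \<bullet> (B *\<^sub>v v) \<le> 1" using u by metis
  next
    assume v: "v \<in> carrier_vec d \<and> (B *\<^sub>v v) \<bullet> (B *\<^sub>v v) \<le> 1"
    have "v = A *\<^sub>v (B *\<^sub>v v)" by (rule mult_mat_vec_inverse[OF A B AB, symmetric]) (use v in blast)
    moreover have "B *\<^sub>v v \<in> centered_ball d 1"
      unfolding mem_unit_ball using v B mult_mat_vec_carrier by blast
    ultimately show "v \<in> ell d A" by (rule image_eqI)
  qed
qed

text \<open>The inverse of \<open>M\<close> times \<open>A\<close> is orthogonal, hence maps the
  unit ball into itself.\<close>

lemma ell_subset_of_gram_eq: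
  assumes A: "A \<in> carrier_mat d d" and M: "M \<in> carrier_mat d d" "invertible_mat M"
    and eq: "A * A\<^sup>T = M * M\<^sup>T"
  shows "ell d A \<subseteq> ell d M"
proof -
  obtain N where N: "N \<in> carrier_mat d d" "M * N = 1\<^sub>m d" "N * M = 1\<^sub>m d"
    using inverse_mat_exists[OF M(2,1)] .
  define W where "W = N * A"
  have W: "W \<in> carrier_mat d d" unfolding W_def using N A by simp
  have "W * W\<^sup>T = N * (A * A\<^sup>T) * N\<^sup>T"
    unfolding W_def using N(1) A by (simp add: transpose_mult[of _ d d _ d] assoc_mult_mat[of _ d d _ d _ d])
  also have "\<dots> = (N * M) * (N * M)\<^sup>T"
    unfolding eq using N(1) M(1) by (simp add: transpose_mult[of _ d d _ d] assoc_mult_mat[of _ d d _ d _ d])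
  also have "\<dots> = 1\<^sub>m d" using N by simp
  finally have WW: "W\<^sup>T * W = 1\<^sub>m d"
    using mat_mult_left_right_inverse W by (metis transpose_carrier_mat)
  show ?thesis
  proof
    fix v assume "v \<in> ell d A"
    then obtain u where u: "u \<in> carrier_vec d" "u \<bullet> u \<le> 1" and v: "v = A *\<^sub>v u"
      by (auto simp: mem_unit_ball)
    have "(W *\<^sub>v u) \<bullet> (W *\<^sub>v u) = u \<bullet> (W\<^sup>T *\<^sub>v (W *\<^sub>v u))"
      by (rule scalar_prod_transpose) (use W u in auto)
    also have "\<dots> = u \<bullet> u" using W u WW by (subst mult_mat_vec_inverse[of _ d]) auto
    finally show "v \<in> ell d M"
      using u A N(1) unfolding mem_ell_iff[OF M(1) N(1,2)] v W_def by simp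
  qed
qed

lemma ell_eq_of_gram_eq:
  assumes "A \<in> carrier_mat d d" "invertible_mat A" "M \<in> carrier_mat d d" "invertible_mat M"
    and "A * A\<^sup>T = M * M\<^sup>T"
  shows "ell d A = ell d M"
  using ell_subset_of_gram_eq[of A d M] ell_subset_of_gram_eq[of M d A] assms by auto

section \<open>Cholesky factors and determinant bounds\<close>

text \<open>Induction that eliminates the variable with index 0. Index functions instead of matrices
  make the passage to the smaller problem a mere shift of indices.\<close>

lemma cholesky_fun:
  fixes a :: "nat \<Rightarrow> nat \<Rightarrow> real"
  assumes "\<And>i j. i < n \<Longrightarrow> j < n \<Longrightarrow> a i j = a j i"
    and "\<And>x. \<exists>i<n. x i \<noteq> 0 \<Longrightarrow> 0 < (\<Sum>i<n. \<Sum>j<n. a i j * x i * x j)"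
  shows "\<exists>L. (\<forall>i j. i < j \<longrightarrow> L i j = 0) \<and> (\<forall>i<n. 0 < L i i) \<and>
     (\<forall>i<n. \<forall>j<n. a i j = (\<Sum>k<n. L i k * L j k))"
  using assms
proof (induction n arbitrary: a)
  case 0
  show ?case by (rule exI[of _ "\<lambda>_ _. 0"]) simp
next
  case (Suc n)
  define p where "p = a 0 0"
  have p: "0 < p"
  proof -
    have "0 < (\<Sum>i<Suc n. \<Sum>j<Suc n. a i j * of_bool (i = 0) * of_bool (j = 0))"
      by (rule Suc.prems(2)) auto
    then show ?thesis
      unfolding p_def sum.lessThan_Suc_shift by simp
  qed
  \<comment> \<open>The Schur complement of the pivot \<open>p\<close>.\<close>
  define b where "b = (\<lambda>i j. a (Suc i) (Suc j) - a (Suc i) 0 * a (Suc j) 0 / p)"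
  have sym_b: "b i j = b j i" if "i < n" "j < n" for i j
    using Suc.prems(1)[of "Suc i" "Suc j"] that by (simp add: b_def)
  have pd_b: "0 < (\<Sum>i<n. \<Sum>j<n. b i j * x i * x j)" if x: "\<exists>i<n. x i \<noteq> 0" for x
  proof -
    define s where "s = (\<Sum>i<n. a (Suc i) 0 * x i)"
    \<comment> \<open>The value -s/p minimises the form in the eliminated variable. There the form
      of \<open>a\<close> equals the form of \<open>b\<close> at \<open>x\<close>, which is
      therefore positive.\<close>
    define y where "y = case_nat (- s / p) x"
    have y[simp]: "y 0 = - s / p" "\<And>i. y (Suc i) = x i" by (auto simp: y_def)
    have row0: "(\<Sum>j<n. a 0 (Suc j) * y 0 * y (Suc j)) = y 0 * s"
    proof -
      have "(\<Sum>j<n. a 0 (Suc j) * y 0 * y (Suc j)) = (\<Sum>j<n. y 0 * (a (Suc j) 0 * x j))"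
        by (rule sum.cong) (use Suc.prems(1)[of 0] in \<open>auto simp del: y(1)\<close>)
      then show ?thesis by (simp add: s_def sum_distrib_left)
    qed
    have col0: "(\<Sum>i<n. a (Suc i) 0 * y (Suc i) * y 0) = y 0 * s"
      by (simp add: s_def sum_distrib_left mult.commute del: y(1))
    have ss: "(\<Sum>i<n. \<Sum>j<n. a (Suc i) 0 * a (Suc j) 0 / p * x i * x j) = s * s / p"
      unfolding s_def sum_product by (simp add: sum_divide_distrib mult_ac)
    have "\<exists>i<Suc n. y i \<noteq> 0" using x y(2) by (metis Suc_less_eq)
    then have "0 < (\<Sum>i<Suc n. \<Sum>j<Suc n. a i j * y i * y j)" by (rule Suc.prems(2))
    also have "\<dots> = p * y 0 * y 0 + y 0 * s + (y 0 * s + (\<Sum>i<n. \<Sum>j<n. a (Suc i) (Suc j) * x i * x j))"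
      unfolding sum.lessThan_Suc_shift sum.distrib row0 col0 by (simp add: p_def)
    also have "\<dots> = (\<Sum>i<n. \<Sum>j<n. a (Suc i) (Suc j) * x i * x j) - s * s / p"
      using p by (simp add: field_simps)
    also have "\<dots> = (\<Sum>i<n. \<Sum>j<n. b i j * x i * x j)"
      unfolding ss[symmetric] b_def by (simp add: left_diff_distrib sum_subtractf)
    finally show ?thesis .
  qed
  obtain L' where L': "\<And>i j. i < j \<Longrightarrow> L' i j = 0" "\<And>i. i < n \<Longrightarrow> 0 < L' i i"
      "\<And>i j. i < n \<Longrightarrow> j < n \<Longrightarrow> b i j = (\<Sum>k<n. L' i k * L' j k)"
    using Suc.IH[of b, OF sym_b pd_b] by blast
  define L where "L = (\<lambda>i j. case i of 0 \<Rightarrow> (case j of 0 \<Rightarrow> sqrt p | Suc _ \<Rightarrow> 0)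
      | Suc i' \<Rightarrow> (case j of 0 \<Rightarrow> a i 0 / sqrt p | Suc j' \<Rightarrow> L' i' j'))"
  have "L i j = 0" if "i < j" for i j
    using that L'(1) by (auto simp: L_def split: nat.splits)
  moreover have "0 < L i i" if "i < Suc n" for i
    using that L'(2) p by (auto simp: L_def split: nat.splits)
  moreover have "a i j = (\<Sum>k<Suc n. L i k * L j k)" if "i < Suc n" "j < Suc n" for i j
  proof (cases i)
    case 0
    have "a 0 j = a j 0" using Suc.prems(1) that 0 by blast
    moreover have "(\<Sum>k<Suc n. L i k * L j k) = L 0 0 * L j 0"
      unfolding sum.lessThan_Suc_shift using 0 by (simp add: L_def)
    moreover have "L 0 0 * L j 0 = a j 0"
      using p by (cases j) (simp_all add: L_def p_def[symmetric])
    ultimately show ?thesis using 0 by simp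
  next
    case (Suc i')
    show ?thesis
    proof (cases j)
      case 0
      then show ?thesis using p Suc by (simp add: sum.lessThan_Suc_shift L_def del: sum.lessThan_Suc)
    next
      case (Suc j')
      then have "a i j = b i' j' + a i 0 * a j 0 / p" by (simp add: b_def \<open>i = Suc i'\<close>)
      moreover have "b i' j' = (\<Sum>k<n. L' i' k * L' j' k)"
        using L'(3) that Suc \<open>i = Suc i'\<close> by simp
      moreover have "(\<Sum>k<Suc n. L i k * L j k) = L i 0 * L j 0 + (\<Sum>k<n. L' i' k * L' j' k)"
        unfolding sum.lessThan_Suc_shift using Suc \<open>i = Suc i'\<close> by (simp add: L_def)
      moreover have "L i 0 * L j 0 = a i 0 * a j 0 / p"
        using Suc \<open>i = Suc i'\<close> p by (simp add: L_def)
      ultimately show ?thesis by linarith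
    qed
  qed
  ultimately show ?case by blast
qed

lemma quadratic_form_eq:
  assumes "M \<in> carrier_mat d d" "v \<in> carrier_vec d"
  shows "v \<bullet> (M *\<^sub>v v) = (\<Sum>i<d. \<Sum>j<d. M $$ (i,j) * v $ i * (v $ j :: real))"
  using assms unfolding scalar_prod_def lessThan_atLeast0
  by (auto simp: scalar_prod_def sum_distrib_left mult_ac intro!: sum.cong)

lemma invertible_mat_iff_det:
  assumes "A \<in> carrier_mat d d"
  shows "invertible_mat A \<longleftrightarrow> det (A :: real mat) \<noteq> 0"
proof
  assume "invertible_mat A"
  then obtain B where "B \<in> carrier_mat d d" "A * B = 1\<^sub>m d"
    using inverse_mat_exists[OF _ assms] by metis
  then show "det A \<noteq> 0" using det_mult[OF assms, of B] by auto
next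
  assume "det A \<noteq> 0"
  from det_non_zero_imp_unit[OF assms this, of undefined]
  obtain B where "B \<in> carrier_mat d d" "A * B = 1\<^sub>m d"
    unfolding Units_def ring_mat_simps by auto
  then show "invertible_mat A" using invertible_matI[OF assms] by blast
qed

lemma det_sq_gram: "A \<in> carrier_mat d d \<Longrightarrow> det (A * A\<^sup>T) = (det A)\<^sup>2"
  by (simp add: det_mult[of _ d] det_transpose[of _ d] power2_eq_square)

text \<open>The Gram matrix is positive definite because its form at \<open>v\<close> is the squared
  length of \<open>A\<^sup>T *\<^sub>v v\<close>, and the transpose of \<open>A\<close> is
  injective. The triangular \<open>L\<close> generates the same ellipsoid as \<open>A\<close>, and
  its determinant is read off the diagonal.\<close>

lemma cholesky:
  assumes A: "(A :: real mat) \<in> carrier_mat d d" "invertible_mat A"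
  obtains L :: "real mat" where "L \<in> carrier_mat d d" "\<And>i j. i < j \<Longrightarrow> j < d \<Longrightarrow> L $$ (i,j) = 0"
    "\<And>i. i < d \<Longrightarrow> 0 < L $$ (i,i)" "L * L\<^sup>T = A * A\<^sup>T" "invertible_mat L"
    "det L = (\<Prod>i<d. L $$ (i,i))"
proof -
  define a where "a = (\<lambda>i j. (A * A\<^sup>T) $$ (i,j))"
  have sym: "a i j = a j i" if "i < d" "j < d" for i j
    using that A by (simp add: a_def comm_scalar_prod[of _ d])
  have pd: "0 < (\<Sum>i<d. \<Sum>j<d. a i j * x i * x j)" if x: "\<exists>i<d. x i \<noteq> 0" for x
  proof -
    define v where "v = Matrix.vec d x"
    have v: "v \<in> carrier_vec d" "v \<noteq> 0\<^sub>v d"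
      using x by (auto simp: v_def) (metis index_vec index_zero_vec(1))
    obtain B where B: "B \<in> carrier_mat d d" "A * B = 1\<^sub>m d" "B * A = 1\<^sub>m d"
      using inverse_mat_exists[OF A(2,1)] .
    have BT: "B\<^sup>T * A\<^sup>T = 1\<^sub>m d"
      using transpose_mult[OF A(1) B(1)] B(2) by simp
    have "A\<^sup>T *\<^sub>v v \<noteq> 0\<^sub>v d"
    proof
      assume "A\<^sup>T *\<^sub>v v = 0\<^sub>v d"
      then have "v = B\<^sup>T *\<^sub>v 0\<^sub>v d"
        using mult_mat_vec_inverse[of "B\<^sup>T" d "A\<^sup>T" v] A B BT v(1) by simp
      moreover have "B\<^sup>T *\<^sub>v 0\<^sub>v d = 0\<^sub>v d" using B(1) by (intro eq_vecI) auto
      ultimately show False using v by simp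
    qed
    then have "0 < (A\<^sup>T *\<^sub>v v) \<bullet> (A\<^sup>T *\<^sub>v v)"
      by (intro scalar_prod_self_pos[of _ d]) (use A v in auto)
    also have "\<dots> = v \<bullet> (A * A\<^sup>T *\<^sub>v v)"
      using scalar_prod_transpose[of "A\<^sup>T" d d v "A\<^sup>T *\<^sub>v v"] A v by simp
    also have "\<dots> = (\<Sum>i<d. \<Sum>j<d. a i j * x i * x j)"
      unfolding a_def using A
      by (subst quadratic_form_eq[of _ d]) (auto simp: v_def intro!: sum.cong)
    finally show ?thesis .
  qed
  obtain f where f: "\<And>i j. i < j \<Longrightarrow> f i j = 0" "\<And>i. i < d \<Longrightarrow> 0 < f i i"
      "\<And>i j. i < d \<Longrightarrow> j < d \<Longrightarrow> a i j = (\<Sum>k<d. f i k * f j k)"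
    using cholesky_fun[of d a, OF sym pd] by blast
  define L where "L = Matrix.mat d d (\<lambda>(i,j). f i j)"
  have L: "L \<in> carrier_mat d d" by (simp add: L_def)
  have zero: "L $$ (i,j) = 0" if "i < j" "j < d" for i j
    using that f(1) by (simp add: L_def)
  have pos: "0 < L $$ (i,i)" if "i < d" for i using that f(2) by (simp add: L_def)
  have LL: "L * L\<^sup>T = A * A\<^sup>T"
  proof (rule eq_matI)
    fix i j assume "i < dim_row (A * A\<^sup>T)" "j < dim_col (A * A\<^sup>T)"
    then have ij: "i < d" "j < d" using A by auto
    then show "(L * L\<^sup>T) $$ (i,j) = (A * A\<^sup>T) $$ (i,j)"
      unfolding a_def[symmetric, THEN fun_cong, THEN fun_cong]
      using f(3)[OF ij] by (simp add: L_def scalar_prod_def lessThan_atLeast0 a_def)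
  qed (use A L in auto)
  have det: "det L = (\<Prod>i<d. L $$ (i,i))"
    using det_lower_triangular[OF zero L] L by (simp add: prod_list_diag_prod lessThan_atLeast0)
  have "det L \<noteq> 0" unfolding det using pos by (force simp: prod_zero_iff)
  then have "invertible_mat L" using invertible_mat_iff_det[OF L] by blast
  then show thesis using that L zero pos LL det by blast
qed

text \<open>Replacing a matrix by its Cholesky factor changes neither the Frobenius norm nor the squared
  determinant, so both are read off a triangular matrix with positive diagonal.\<close>

lemma cholesky_fro_det:
  assumes A: "(A :: real mat) \<in> carrier_mat d d" "invertible_mat A"
  obtains L where "L \<in> carrier_mat d d" "\<And>i. i < d \<Longrightarrow> 0 < L $$ (i,i)" "L * L\<^sup>T = A * A\<^sup>T"
    "fro A = (\<Sum>i<d. \<Sum>j<d. (L $$ (i,j))\<^sup>2)" "ln ((det A)\<^sup>2) = (\<Sum>i<d. ln ((L $$ (i,i))\<^sup>2))"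
proof -
  obtain L where L: "L \<in> carrier_mat d d" "\<And>i j. i < j \<Longrightarrow> j < d \<Longrightarrow> L $$ (i,j) = 0"
    "\<And>i. i < d \<Longrightarrow> 0 < L $$ (i,i)" "L * L\<^sup>T = A * A\<^sup>T" "invertible_mat L"
    "det L = (\<Prod>i<d. L $$ (i,i))" by (rule cholesky[OF A]) blast
  have "(det A)\<^sup>2 = (\<Prod>i<d. (L $$ (i,i))\<^sup>2)"
    using det_sq_gram[OF A(1)] det_sq_gram[OF L(1)] L(4,6) by (simp add: prod_power_distrib)
  moreover have "ln (\<Prod>i<d. (L $$ (i,i))\<^sup>2) = (\<Sum>i<d. ln ((L $$ (i,i))\<^sup>2))"
  proof (rule ln_prod)
    show "(L $$ (i,i))\<^sup>2 \<noteq> 0" if "i \<in> {..<d}" for i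
      using L(3)[of i] that by simp
  qed simp
  moreover have "fro A = fro L" using fro_gram[OF A(1)] fro_gram[OF L(1)] L(4) by simp
  ultimately show thesis using that[of L] L by (simp add: fro_def lessThan_atLeast0)
qed

lemma sum_row_split:
  "(i :: nat) < d \<Longrightarrow> (\<Sum>j<d. (f j)\<^sup>2) = (f i)\<^sup>2 + (\<Sum>j\<in>{..<d} - {i}. (f j :: real)\<^sup>2)"
  using sum.remove[of "{..<d}" i "\<lambda>j. (f j)\<^sup>2"] by simp

text \<open>AM-GM with a free scale: the tangent of ln at \<open>b\<close> gives ln t <= ln b + t/b
  - 1 for each squared diagonal entry of the Cholesky factor, and the off-diagonal squares only
  enlarge the right-hand side.\<close>

lemma ln_det_sq_le:
  assumes A: "A \<in> carrier_mat d d" "invertible_mat A" and b: "0 < b"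
  shows "ln ((det A)\<^sup>2) \<le> d * ln b + fro A / b - d"
proof -
  obtain L where L: "L \<in> carrier_mat d d" "\<And>i. i < d \<Longrightarrow> 0 < L $$ (i,i)" and "L * L\<^sup>T = A * A\<^sup>T"
    and L34: "fro A = (\<Sum>i<d. \<Sum>j<d. (L $$ (i,j))\<^sup>2)" "ln ((det A)\<^sup>2) = (\<Sum>i<d. ln ((L $$ (i,i))\<^sup>2))"
    by (rule cholesky_fro_det[OF A]) blast
  have "ln ((L $$ (i,i))\<^sup>2) \<le> ln b + (\<Sum>j<d. (L $$ (i,j))\<^sup>2) / b - 1" if i: "i < d" for i
  proof -
    let ?l = "L $$ (i,i)"
    have l: "0 < ?l" using L(2) i .
    have "ln (?l\<^sup>2 / b) \<le> ?l\<^sup>2 / b - 1" using l b by (intro ln_le_minus_one) simp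
    moreover have "ln (?l\<^sup>2 / b) = ln (?l\<^sup>2) - ln b" using l b by (simp add: ln_div)
    moreover have "?l\<^sup>2 / b \<le> (\<Sum>j<d. (L $$ (i,j))\<^sup>2) / b"
      unfolding sum_row_split[OF i] using b by (simp add: divide_right_mono sum_nonneg)
    ultimately show ?thesis by linarith
  qed
  then have "(\<Sum>i<d. ln ((L $$ (i,i))\<^sup>2)) \<le> (\<Sum>i<d. ln b + (\<Sum>j<d. (L $$ (i,j))\<^sup>2) / b - 1)"
    by (intro sum_mono) auto
  then show ?thesis unfolding L34
    by (simp add: sum.distrib sum_subtractf sum_divide_distrib)
qed

text \<open>The equality case of AM-GM. The slack \<open>fro A - d - ln ((det A)\<^sup>2)\<close> is
  a sum of nonnegative terms: \<open>g i\<close> vanishes only for diagonal entry 1,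
  \<open>h i\<close> only when the rest of the row is zero. If the slack is not positive, the
  Cholesky factor is the identity. This is the source of uniqueness of the smallest
  ellipsoid.\<close>

lemma gram_eq_one_of_fro_le:
  assumes A: "A \<in> carrier_mat d d" and fro: "fro A \<le> d" and det: "1 \<le> (det A)\<^sup>2"
  shows "A * A\<^sup>T = 1\<^sub>m d"
proof -
  have inv: "invertible_mat A" using det invertible_mat_iff_det[OF A] by auto
  obtain L where L: "L \<in> carrier_mat d d" "\<And>i. i < d \<Longrightarrow> 0 < L $$ (i,i)" "L * L\<^sup>T = A * A\<^sup>T"
    "fro A = (\<Sum>i<d. \<Sum>j<d. (L $$ (i,j))\<^sup>2)" "ln ((det A)\<^sup>2) = (\<Sum>i<d. ln ((L $$ (i,i))\<^sup>2))"
    by (rule cholesky_fro_det[OF A inv]) blast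
  define g where "g = (\<lambda>i. ((L $$ (i,i))\<^sup>2 - 1 - ln ((L $$ (i,i))\<^sup>2)))"
  define h where "h = (\<lambda>i. \<Sum>j\<in>{..<d} - {i}. (L $$ (i,j))\<^sup>2)"
  have g0: "0 \<le> g i" if "i < d" for i
    using ln_le_minus_one[of "(L $$ (i,i))\<^sup>2"] L(2)[OF that] by (simp add: g_def)
  have h0: "0 \<le> h i" for i by (simp add: h_def sum_nonneg)
  have "(\<Sum>i<d. g i + h i) = fro A - d - ln ((det A)\<^sup>2)"
    unfolding L(4,5) by (simp add: g_def h_def sum.distrib sum_subtractf sum_row_split[of _ d])
  also have "\<dots> \<le> 0" using fro ln_ge_zero[OF det] by linarith
  finally have "(\<Sum>i<d. g i + h i) = 0"
    using g0 h0 by (intro antisym sum_nonneg) (auto simp: add_nonneg_nonneg)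
  then have "\<forall>i\<in>{..<d}. g i + h i = 0"
    using g0 h0 by (subst (asm) sum_nonneg_eq_0_iff) (auto simp: add_nonneg_nonneg)
  then have "g i + h i = 0" if "i < d" for i using that by blast
  then have "g i = 0 \<and> h i = 0" if "i < d" for i
    using g0[OF that] h0[of i] that add_nonneg_eq_0_iff by blast
  then have gh: "\<And>i. i < d \<Longrightarrow> g i = 0" "\<And>i. i < d \<Longrightarrow> h i = 0" by auto
  have "L = 1\<^sub>m d"
  proof (rule eq_matI)
    fix i j assume "i < dim_row (1\<^sub>m d :: real mat)" "j < dim_col (1\<^sub>m d :: real mat)"
    then have ij: "i < d" "j < d" by auto
    show "L $$ (i,j) = 1\<^sub>m d $$ (i,j)"
    proof (cases "i = j")
      case True
      have "(L $$ (i,i))\<^sup>2 = 1"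
        using gh(1)[OF ij(1)] L(2)[OF ij(1)] ln_eq_minus_one[of "(L $$ (i,i))\<^sup>2"] by (simp add: g_def)
      then show ?thesis using True ij L(2)[OF ij(1)] by (simp add: power2_eq_1_iff)
    next
      case False
      have "\<forall>j\<in>{..<d} - {i}. (L $$ (i,j))\<^sup>2 = 0"
        using gh(2)[OF ij(1)] unfolding h_def by (subst (asm) sum_nonneg_eq_0_iff) auto
      then show ?thesis using False ij by auto
    qed
  qed (use L in auto)
  then show ?thesis using L(3) by simp
qed

lemma det_sq_le_one_of_fro_le:
  assumes A: "A \<in> carrier_mat d d" and fro: "fro A \<le> d"
  shows "(det A)\<^sup>2 \<le> 1"
proof (cases "det A = 0")
  case False
  then have "ln ((det A)\<^sup>2) \<le> fro A - d"
    using ln_det_sq_le[OF A, of 1] invertible_mat_iff_det[OF A] by simp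
  then have "ln ((det A)\<^sup>2) \<le> 0" using fro by linarith
  moreover have "0 < (det A)\<^sup>2" using False by simp
  ultimately show ?thesis using ln_le_zero_iff by blast
qed simp

section \<open>Volumes of ellipsoids\<close>

abbreviation lborel_pow :: "nat \<Rightarrow> (nat \<Rightarrow> real) measure" where
  "lborel_pow n \<equiv> \<Pi>\<^sub>M i\<in>{..<n}. (lborel :: real measure)"

text \<open>Multiplication by the lower triangular part of \<open>L\<close>, acting on the
  extensional functions that carry the product measure.\<close>

definition tri_map :: "nat \<Rightarrow> (nat \<Rightarrow> nat \<Rightarrow> real) \<Rightarrow> (nat \<Rightarrow> real) \<Rightarrow> nat \<Rightarrow> real" where
  "tri_map n L f = (\<lambda>i\<in>{..<n}. \<Sum>j\<le>i. L i j * f j)"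

lemma measurable_tri_map: "tri_map n L \<in> measurable (lborel_pow n) (lborel_pow n)"
proof -
  have "(\<lambda>f. \<lambda>i\<in>{..<n}. \<Sum>j\<le>i. L i j * f j) \<in> measurable (lborel_pow n) (lborel_pow n)"
  proof (rule measurable_restrict)
    fix i assume i: "i \<in> {..<n}"
    have c: "(\<lambda>f. f j) \<in> borel_measurable (lborel_pow n)" if "j \<le> i" for j
      using measurable_component_singleton[of j "{..<n}" "\<lambda>_. lborel :: real measure"] that i by auto
    have "(\<lambda>f. \<Sum>j\<le>i. L i j * f j) \<in> borel_measurable (lborel_pow n)"
      by (intro borel_measurable_sum borel_measurable_times borel_measurable_const c) auto
    then show "(\<lambda>f. \<Sum>j\<le>i. L i j * f j) \<in> measurable (lborel_pow n) lborel" by simp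
  qed
  then show ?thesis unfolding tri_map_def[abs_def] .
qed

lemma tri_map_Suc:
  assumes "f \<in> space (lborel_pow n)"
  shows "tri_map (Suc n) L (f(n := y)) = (tri_map n L f)(n := (\<Sum>j<n. L n j * f j) + L n n * y)"
proof
  fix i
  have "(\<Sum>j\<le>i. L i j * (f(n := y)) j) = (\<Sum>j\<le>i. L i j * f j)" if "i < n"
    using that by (intro sum.cong) auto
  moreover have "(\<Sum>j\<le>n. L n j * (f(n := y)) j) = (\<Sum>j<n. L n j * f j) + L n n * y"
    by (simp add: lessThan_Suc_atMost[symmetric])
  ultimately show "tri_map (Suc n) L (f(n := y)) i
      = ((tri_map n L f)(n := (\<Sum>j<n. L n j * f j) + L n n * y)) i"
    by (auto simp: tri_map_def restrict_def)
qed

text \<open>Change of variables by Fubini. With the earlier coordinates fixed, the last coordinate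
  of the image is affine in the last variable with slope \<open>L n n\<close>, so integrating it out
  contributes the factor |L n n|; the remaining coordinates do not involve that variable and fall
  under the induction hypothesis.\<close>

lemma nn_integral_tri_map:
  assumes "h \<in> borel_measurable (lborel_pow n)" "\<And>i. i < n \<Longrightarrow> L i i \<noteq> 0"
  shows "(\<integral>\<^sup>+f. h f \<partial>lborel_pow n)
    = ennreal (\<Prod>i<n. \<bar>L i i\<bar>) * (\<integral>\<^sup>+f. h (tri_map n L f) \<partial>lborel_pow n)"
  using assms
proof (induction n arbitrary: h)
  case 0
  have "(\<integral>\<^sup>+f. h f \<partial>lborel_pow 0) = (\<integral>\<^sup>+f. h (tri_map 0 L f) \<partial>lborel_pow 0)"
    by (rule nn_integral_cong) (auto simp: space_PiM tri_map_def restrict_def)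
  then show ?case by simp
next
  case (Suc n)
  interpret product_sigma_finite "\<lambda>_ :: nat. lborel :: real measure"
    by standard
  have ins: "{..<Suc n} = insert n {..<n}" by auto
  have h: "h \<in> borel_measurable (Pi\<^sub>M (insert n {..<n}) (\<lambda>_. lborel))"
    using Suc.prems(1) unfolding ins .
  define T where "T = tri_map (Suc n) L"
  have hT: "(\<lambda>f. h (T f)) \<in> borel_measurable (Pi\<^sub>M (insert n {..<n}) (\<lambda>_. lborel))"
    using measurable_compose[OF measurable_tri_map[of "Suc n" L] Suc.prems(1)] unfolding ins T_def .
  have joint: "(\<lambda>f. \<integral>\<^sup>+y. k (f(n := y)) \<partial>lborel) \<in> borel_measurable (lborel_pow n)"
    if "k \<in> borel_measurable (Pi\<^sub>M (insert n {..<n}) (\<lambda>_. lborel))" for k :: "_ \<Rightarrow> ennreal"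
  proof -
    have "case_prod (\<lambda>f y. k (f(n := y))) \<in> borel_measurable (lborel_pow n \<Otimes>\<^sub>M lborel)"
      using measurable_compose[OF measurable_add_dim that] by (simp add: split_beta')
    then show ?thesis by (rule lborel.borel_measurable_nn_integral)
  qed
  define H where "H = (\<lambda>f. \<integral>\<^sup>+y. h (f(n := y)) \<partial>lborel)"
  have H_tri: "H (tri_map n L f) = ennreal \<bar>L n n\<bar> * (\<integral>\<^sup>+y. h (T (f(n := y))) \<partial>lborel)"
    if f: "f \<in> space (lborel_pow n)" for f
  proof -
    have "tri_map n L f \<in> space (lborel_pow n)"
      using measurable_space[OF measurable_tri_map f] .
    then have "(\<lambda>y. (tri_map n L f)(n := y)) \<in> measurable lborel (Pi\<^sub>M (insert n {..<n}) (\<lambda>_. lborel))"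
      by (rule measurable_component_update) simp
    from measurable_compose[OF this h]
    have "(\<lambda>y. h ((tri_map n L f)(n := y))) \<in> borel_measurable borel" by simp
    from nn_integral_real_affine[OF this, of "L n n" "\<Sum>j<n. L n j * f j"] Suc.prems(2)[of n]
    show ?thesis unfolding H_def T_def tri_map_Suc[OF f] by simp
  qed
  have "(\<integral>\<^sup>+f. h f \<partial>lborel_pow (Suc n)) = (\<integral>\<^sup>+f. H f \<partial>lborel_pow n)"
    unfolding ins H_def by (rule product_nn_integral_insert) (use h in auto)
  also have "\<dots> = ennreal (\<Prod>i<n. \<bar>L i i\<bar>) * (\<integral>\<^sup>+f. H (tri_map n L f) \<partial>lborel_pow n)"
    by (rule Suc.IH) (use joint[OF h] Suc.prems(2) in \<open>auto simp: H_def\<close>)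
  also have "(\<integral>\<^sup>+f. H (tri_map n L f) \<partial>lborel_pow n)
      = (\<integral>\<^sup>+f. ennreal \<bar>L n n\<bar> * (\<integral>\<^sup>+y. h (T (f(n := y))) \<partial>lborel) \<partial>lborel_pow n)"
    by (rule nn_integral_cong) (rule H_tri)
  also have "\<dots> = ennreal \<bar>L n n\<bar> * (\<integral>\<^sup>+f. (\<integral>\<^sup>+y. h (T (f(n := y))) \<partial>lborel) \<partial>lborel_pow n)"
    by (rule nn_integral_cmult) (rule joint[OF hT])
  also have "(\<integral>\<^sup>+f. (\<integral>\<^sup>+y. h (T (f(n := y))) \<partial>lborel) \<partial>lborel_pow n) = (\<integral>\<^sup>+f. h (T f) \<partial>lborel_pow (Suc n))"
    unfolding ins by (rule product_nn_integral_insert[symmetric]) (use hT in auto)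
  finally show ?case
    by (simp add: T_def ennreal_mult prod_nonneg mult.assoc)
qed

lemma volume_eq_nn_integral:
  assumes "{f \<in> {..<d} \<rightarrow>\<^sub>E UNIV. Matrix.vec d f \<in> S} \<in> sets (lborel_pow d)"
  shows "volume d S = (\<integral>\<^sup>+f. indicator {f \<in> {..<d} \<rightarrow>\<^sub>E UNIV. Matrix.vec d f \<in> S} f \<partial>lborel_pow d)"
  unfolding volume_def using assms by simp

lemma ell_one: "ell d (1\<^sub>m d) = centered_ball d 1"
proof -
  have "u \<in> carrier_vec d" if "u \<in> centered_ball d 1" for u using that by (simp add: mem_unit_ball)
  then show ?thesis by (force simp: image_iff)
qed

text \<open>Measurability matters: \<open>emeasure\<close> is 0 by convention on non-measurable
  sets. The ellipsoid is a sublevel set of a polynomial in the coordinates.\<close>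

lemma sets_ell:
  assumes A: "A \<in> carrier_mat d d" "invertible_mat A"
  shows "{f \<in> {..<d} \<rightarrow>\<^sub>E UNIV. Matrix.vec d f \<in> ell d A} \<in> sets (lborel_pow d)"
proof -
  obtain N where N: "N \<in> carrier_mat d d" "A * N = 1\<^sub>m d" "N * A = 1\<^sub>m d"
    using inverse_mat_exists[OF A(2,1)] .
  have c: "(\<lambda>f. f j) \<in> borel_measurable (lborel_pow d)" if "j < d" for j
    using measurable_component_singleton[of j "{..<d}" "\<lambda>_. lborel :: real measure"] that by auto
  define q where "q = (\<lambda>f. \<Sum>i<d. (\<Sum>j<d. N $$ (i,j) * f j)\<^sup>2)"
  have "q \<in> borel_measurable (lborel_pow d)"
    unfolding q_def
    by (intro borel_measurable_sum borel_measurable_power borel_measurable_times borel_measurable_const c) auto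
  then have "{f \<in> space (lborel_pow d). q f \<le> 1} \<in> sets (lborel_pow d)"
    by (rule borel_measurable_le) simp
  moreover have "(N *\<^sub>v Matrix.vec d f) \<bullet> (N *\<^sub>v Matrix.vec d f) = q f" for f
    using N(1) unfolding q_def scalar_prod_self_eq
    by (auto simp: scalar_prod_def lessThan_atLeast0 intro!: sum.cong)
  then have "{f \<in> {..<d} \<rightarrow>\<^sub>E UNIV. Matrix.vec d f \<in> ell d A} = {f \<in> space (lborel_pow d). q f \<le> 1}"
    unfolding mem_ell_iff[OF A(1) N(1,2)] by (auto simp: space_PiM)
  ultimately show ?thesis by simp
qed

text \<open>Passing to the Cholesky factor changes neither the set nor |det A|. Substituting
  \<open>tri_map\<close> then turns the indicator of the ellipsoid into that of the unit
  ball.\<close>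

lemma volume_ell:
  assumes A: "A \<in> carrier_mat d d" "invertible_mat A"
  shows "volume d (ell d A) = ennreal \<bar>det A\<bar> * volume d (centered_ball d 1)"
proof -
  obtain L :: "real mat" where L: "L \<in> carrier_mat d d" "\<And>i j. i < j \<Longrightarrow> j < d \<Longrightarrow> L $$ (i,j) = 0"
    "\<And>i. i < d \<Longrightarrow> 0 < L $$ (i,i)" "L * L\<^sup>T = A * A\<^sup>T" "invertible_mat L"
    "det L = (\<Prod>i<d. L $$ (i,i))" by (rule cholesky[OF A]) blast
  have "(det A)\<^sup>2 = (det L)\<^sup>2"
    using det_sq_gram[OF A(1)] det_sq_gram[OF L(1)] L(4) by simp
  then have "\<bar>det A\<bar> = \<bar>det L\<bar>" using power2_eq_iff by fastforce
  then have det: "\<bar>det A\<bar> = (\<Prod>i<d. \<bar>L $$ (i,i)\<bar>)" unfolding L(6) by (simp add: abs_prod)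
  obtain N where N: "N \<in> carrier_mat d d" "L * N = 1\<^sub>m d" "N * L = 1\<^sub>m d"
    using inverse_mat_exists[OF L(5,1)] .
  let ?T = "tri_map d (\<lambda>i j. L $$ (i,j))"
  let ?E = "\<lambda>S. {f \<in> {..<d} \<rightarrow>\<^sub>E UNIV. Matrix.vec d f \<in> S}"
  have sets: "?E (ell d L) \<in> sets (lborel_pow d)" by (rule sets_ell[OF L(1,5)])
  have one: "invertible_mat (1\<^sub>m d :: real mat)"
    by (rule invertible_matI[of _ d "1\<^sub>m d"]) auto
  have vecT: "Matrix.vec d (?T f) = L *\<^sub>v Matrix.vec d f" for f
  proof (rule eq_vecI)
    fix i assume "i < dim_vec (L *\<^sub>v Matrix.vec d f)"
    then have i: "i < d" using L(1) by simp
    have "(\<Sum>j\<le>i. L $$ (i,j) * f j) = (\<Sum>j\<in>{0..<d}. L $$ (i,j) * f j)"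
      by (rule sum.mono_neutral_left) (use i L(2) in auto)
    then show "Matrix.vec d (?T f) $ i = (L *\<^sub>v Matrix.vec d f) $ i"
      using i L(1) by (simp add: tri_map_def scalar_prod_def)
  qed (use L in simp)
  have ind: "indicator (?E (ell d L)) (?T f) = (indicator (?E (centered_ball d 1)) f :: ennreal)"
    if f: "f \<in> space (lborel_pow d)" for f
  proof -
    have "?T f \<in> {..<d} \<rightarrow>\<^sub>E UNIV" by (simp add: tri_map_def)
    moreover have "f \<in> {..<d} \<rightarrow>\<^sub>E UNIV" using f by (simp add: space_PiM)
    moreover have "N *\<^sub>v (L *\<^sub>v Matrix.vec d f) = Matrix.vec d f"
      by (rule mult_mat_vec_inverse[OF N(1) L(1) N(3)]) simp
    ultimately show ?thesis
      unfolding indicator_def mem_Collect_eq vecT mem_ell_iff[OF L(1) N(1,2)] mem_unit_ball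
      using mult_mat_vec_carrier[OF L(1), of "Matrix.vec d f"] by simp
  qed
  have "volume d (ell d A) = volume d (ell d L)"
    using ell_eq_of_gram_eq[OF A L(1,5) L(4)[symmetric]] by simp
  also have "\<dots> = (\<integral>\<^sup>+f. indicator (?E (ell d L)) f \<partial>lborel_pow d)"
    by (rule volume_eq_nn_integral[OF sets])
  also have "\<dots> = ennreal (\<Prod>i<d. \<bar>L $$ (i,i)\<bar>) * (\<integral>\<^sup>+f. indicator (?E (ell d L)) (?T f) \<partial>lborel_pow d)"
    by (rule nn_integral_tri_map) (use sets L(3) in \<open>auto simp: less_imp_neq[symmetric]\<close>)
  also have "(\<integral>\<^sup>+f. indicator (?E (ell d L)) (?T f) \<partial>lborel_pow d)
      = (\<integral>\<^sup>+f. indicator (?E (centered_ball d 1)) f \<partial>lborel_pow d)"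
    by (rule nn_integral_cong) (rule ind)
  also have "\<dots> = volume d (centered_ball d 1)"
    by (rule volume_eq_nn_integral[symmetric]) (use sets_ell[OF one_carrier_mat one] in \<open>simp add: ell_one\<close>)
  finally show ?thesis unfolding det .
qed

lemma sets_ball: "{f \<in> {..<d} \<rightarrow>\<^sub>E UNIV. Matrix.vec d f \<in> centered_ball d 1} \<in> sets (lborel_pow d)"
  using sets_ell[of "1\<^sub>m d" d] invertible_matI[of "1\<^sub>m d" d "1\<^sub>m d"] by (simp add: ell_one)

text \<open>Both bounds are what allows this factor to be cancelled when volumes are compared. They
  come from an inscribed and a circumscribed box.\<close>

lemma volume_unit_ball: "0 < volume d (centered_ball d 1)" "volume d (centered_ball d 1) < \<infinity>"
proof -
  interpret product_sigma_finite "\<lambda>_ :: nat. lborel :: real measure"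
    by standard
  let ?E = "{f \<in> {..<d} \<rightarrow>\<^sub>E UNIV. Matrix.vec d f \<in> centered_ball d 1}"
  let ?box = "\<lambda>c. {..<d} \<rightarrow>\<^sub>E {-c..c :: real}"
  have box: "emeasure (lborel_pow d) (?box c) = ennreal ((2 * c) ^ d)" if "0 \<le> c" for c
    using that by (subst emeasure_PiM) (auto simp: ennreal_power)
  have box_sets: "?box c \<in> sets (lborel_pow d)" for c by (intro sets_PiM_I_finite) auto
  have mem: "f \<in> ?E \<longleftrightarrow> f \<in> {..<d} \<rightarrow>\<^sub>E UNIV \<and> (\<Sum>i<d. (f i)\<^sup>2) \<le> 1" for f
    by (auto simp: mem_unit_ball scalar_prod_self_eq lessThan_atLeast0)
  \<comment> \<open>Half-width 1/d suffices since d (1/d)^2 <= 1. For \<open>d = 0\<close> the space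
    is a single point of measure 1 and 1/0 = 0 does no harm.\<close>
  have "?box (1 / d) \<subseteq> ?E"
  proof
    fix f assume f: "f \<in> ?box (1 / d)"
    have "(f i)\<^sup>2 \<le> (1 / d)\<^sup>2" if "i < d" for i
    proof -
      have "\<bar>f i\<bar> \<le> 1 / d" using PiE_mem[OF f, of i] that by auto
      then show ?thesis using power_mono[of "\<bar>f i\<bar>" "1 / d" 2] by simp
    qed
    then have "(\<Sum>i<d. (f i)\<^sup>2) \<le> d * (1 / d)\<^sup>2"
      using sum_mono[of "{..<d}" "\<lambda>i. (f i)\<^sup>2" "\<lambda>_. (1 / d)\<^sup>2"] by simp
    also have "\<dots> \<le> 1" by (cases "d = 0") (auto simp: power2_eq_square field_simps)
    finally show "f \<in> ?E" using f unfolding mem by auto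
  qed
  from emeasure_mono[OF this sets_ball] have "ennreal ((2 * (1 / d)) ^ d) \<le> volume d (centered_ball d 1)"
    unfolding volume_def by (simp only: box[of "1 / real d"] of_nat_0_le_iff zero_le_divide_1_iff)
  moreover have "0 < (2 * (1 / real d)) ^ d" by (cases "d = 0") auto
  ultimately show "0 < volume d (centered_ball d 1)"
    by (metis ennreal_less_zero_iff less_le_trans)
  have "?E \<subseteq> ?box 1"
  proof
    fix f assume f: "f \<in> ?E"
    have "\<bar>f i\<bar> \<le> 1" if "i < d" for i
    proof -
      have "(f i)\<^sup>2 \<le> (\<Sum>i<d. (f i)\<^sup>2)" by (rule member_le_sum) (use that in auto)
      then have "(f i)\<^sup>2 \<le> 1" using f unfolding mem by linarith
      then show ?thesis by (simp add: abs_square_le_1)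
    qed
    then show "f \<in> ?box 1" using f by (auto simp: PiE_iff abs_le_iff minus_le_iff)
  qed
  from emeasure_mono[OF this box_sets] have "volume d (centered_ball d 1) \<le> ennreal ((2 * 1) ^ d)"
    unfolding volume_def by (simp only: box[OF zero_le_one])
  then show "volume d (centered_ball d 1) < \<infinity>"
    using ennreal_less_top le_less_trans by (metis infinity_ennreal_def)
qed

lemma volume_ell_le_iff:
  assumes "A \<in> carrier_mat d d" "invertible_mat A" "B \<in> carrier_mat d d" "invertible_mat B"
  shows "volume d (ell d A) \<le> volume d (ell d B) \<longleftrightarrow> \<bar>det A\<bar> \<le> \<bar>det B\<bar>"
  unfolding volume_ell[OF assms(1,2)] volume_ell[OF assms(3,4)]
  using volume_unit_ball[of d]
  by (simp add: ennreal_mult_le_mult_iff mult.commute[of "ennreal _"] less_top)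

section \<open>The smallest ellipsoid containing one more point\<close>

text \<open>An optimality certificate. With \<open>W = N * M'\<close> one has det W * det M = det
  M', so \<open>fro W \<le> d\<close> gives |det M'| <= |det M|; equality makes \<open>W\<close>
  orthogonal and the two ellipsoids equal. Hence \<open>ell d M'\<close> is a minimiser and the only
  one, as \<open>THE\<close> demands.\<close>

lemma min_ellipsoid_eqI:
  assumes M': "M' \<in> carrier_mat d d" "invertible_mat M'" and sub: "S \<subseteq> ell d M'"
    and opt: "\<And>M N. M \<in> carrier_mat d d \<Longrightarrow> N \<in> carrier_mat d d \<Longrightarrow> M * N = 1\<^sub>m d \<Longrightarrow> N * M = 1\<^sub>m d \<Longrightarrow>
        S \<subseteq> ell d M \<Longrightarrow> fro (N * M') \<le> d"
  shows "min_ellipsoid d S = ell d M'"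
proof -
  have key: "\<bar>det M'\<bar> \<le> \<bar>det M\<bar> \<and> (\<bar>det M\<bar> \<le> \<bar>det M'\<bar> \<longrightarrow> ell d M = ell d M')"
    if M: "M \<in> carrier_mat d d" "invertible_mat M" and SM: "S \<subseteq> ell d M" for M
  proof -
    obtain N where N: "N \<in> carrier_mat d d" "M * N = 1\<^sub>m d" "N * M = 1\<^sub>m d"
      using inverse_mat_exists[OF M(2,1)] .
    define W where "W = N * M'"
    have W: "W \<in> carrier_mat d d" using N(1) M'(1) by (simp add: W_def)
    have fro: "fro W \<le> d" unfolding W_def by (rule opt[OF M(1) N SM])
    have detN: "det M * det N = 1" using det_mult[OF M(1) N(1)] N(2) by simp
    have detW: "det W * det M = det M'"
      using detN det_mult[OF N(1) M'(1)] by (simp add: W_def algebra_simps)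
    have "\<bar>det W\<bar> \<le> 1" using det_sq_le_one_of_fro_le[OF W fro] by (simp add: abs_square_le_1)
    then have "\<bar>det W\<bar> * \<bar>det M\<bar> \<le> 1 * \<bar>det M\<bar>" by (intro mult_right_mono) auto
    then have le: "\<bar>det M'\<bar> \<le> \<bar>det M\<bar>" using detW by (metis abs_mult mult_1)
    have "ell d M = ell d M'" if ge: "\<bar>det M\<bar> \<le> \<bar>det M'\<bar>"
    proof -
      have "\<bar>det W\<bar> * \<bar>det M\<bar> = 1 * \<bar>det M\<bar>" using le ge detW by (metis abs_mult antisym mult_1)
      then have "\<bar>det W\<bar> = 1" using detN by auto
      then have "(det W)\<^sup>2 = 1" by (metis one_power2 power2_abs)
      then have WW: "W * W\<^sup>T = 1\<^sub>m d" using gram_eq_one_of_fro_le[OF W fro] by simp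
      have "M * W = M'"
        unfolding W_def using assoc_mult_mat[OF M(1) N(1) M'(1)] N(2) M'(1) by simp
      then have "M' * M'\<^sup>T = (M * W) * (M * W)\<^sup>T" by simp
      also have "\<dots> = M * (W * W\<^sup>T) * M\<^sup>T"
        using M(1) W by (simp add: transpose_mult[of _ d d _ d] assoc_mult_mat[of _ d d _ d _ d])
      also have "\<dots> = M * M\<^sup>T" unfolding WW using M(1) by simp
      finally show ?thesis using ell_eq_of_gram_eq[OF M M'] by simp
    qed
    then show ?thesis using le by blast
  qed
  have ellI: "is_ellipsoid d (ell d M')" unfolding is_ellipsoid_def using M' by blast
  have min: "is_min_ellipsoid d S (ell d M')"
    unfolding is_min_ellipsoid_def
  proof (intro conjI allI impI ellI sub)
    fix F assume F: "is_ellipsoid d F \<and> S \<subseteq> F"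
    then obtain M where M: "M \<in> carrier_mat d d" "invertible_mat M" and "F = ell d M"
      unfolding is_ellipsoid_def by blast
    then show "volume d (ell d M') \<le> volume d F"
      using volume_ell_le_iff[OF M' M] key[OF M] F by blast
  qed
  show ?thesis unfolding min_ellipsoid_def
  proof (rule the_equality[where P = "is_min_ellipsoid d S", OF min])
    fix F assume F: "is_min_ellipsoid d S F"
    then obtain M where M: "M \<in> carrier_mat d d" "invertible_mat M" and FM: "F = ell d M"
      unfolding is_ellipsoid_def is_min_ellipsoid_def by blast
    moreover have "volume d F \<le> volume d (ell d M')" "S \<subseteq> F"
      using F ellI sub unfolding is_min_ellipsoid_def by blast+
    ultimately show "F = ell d M'"
      using volume_ell_le_iff[OF M M'] key[OF M] by blast
  qed
qed

lemma stretch_vec_norm: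
  assumes "u \<in> carrier_vec d" "u \<bullet> u = 1" "x \<in> carrier_vec d"
  shows "(stretch d u a *\<^sub>v x) \<bullet> (stretch d u a *\<^sub>v x) = x \<bullet> x + (2 * a + a\<^sup>2) * (x \<bullet> u)\<^sup>2"
  unfolding stretch_mult_vec[OF assms(1,3)] scalar_prod_add_smult_self[OF assms(3,1)] assms(2)
  by (simp add: power2_eq_square algebra_simps)

text \<open>Inclusion of the ellipsoids says that \<open>N * A\<close> maps the unit ball into
  itself; normalising a nonzero \<open>x\<close> and scaling back gives the bound for all
  lengths.\<close>

lemma contraction_of_ell_subset:
  assumes A: "A \<in> carrier_mat d d" and M: "M \<in> carrier_mat d d" "N \<in> carrier_mat d d" "M * N = 1\<^sub>m d"
    and sub: "ell d A \<subseteq> ell d M" and x: "x \<in> carrier_vec d"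
  shows "(N * A *\<^sub>v x) \<bullet> (N * A *\<^sub>v x) \<le> x \<bullet> x"
proof (cases "x = 0\<^sub>v d")
  case True
  have "C *\<^sub>v 0\<^sub>v d = 0\<^sub>v d" if "C \<in> carrier_mat d d" for C :: "real mat"
    using that by (intro eq_vecI) auto
  from this[of "N * A"] have "N * A *\<^sub>v x = 0\<^sub>v d" unfolding True using A M by simp
  then show ?thesis using True by simp
next
  case False
  define s where "s = sqrt (x \<bullet> x)"
  have xx: "0 < x \<bullet> x" using scalar_prod_self_pos[OF x False] .
  then have s: "0 < s" "s\<^sup>2 = x \<bullet> x" by (auto simp: s_def)
  let ?z = "(1 / s) \<cdot>\<^sub>v x"
  have "?z \<bullet> ?z = (1 / s)\<^sup>2 * s\<^sup>2"
    using x by (simp add: s(2)[symmetric] power2_eq_square)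
  then have "?z \<in> centered_ball d 1" using x s(1) by (simp add: mem_unit_ball power2_eq_square)
  then have "A *\<^sub>v ?z \<in> ell d M" using sub by blast
  then have le: "(N *\<^sub>v (A *\<^sub>v ?z)) \<bullet> (N *\<^sub>v (A *\<^sub>v ?z)) \<le> 1"
    unfolding mem_ell_iff[OF M] by blast
  have NAz: "N *\<^sub>v (A *\<^sub>v ?z) = (1 / s) \<cdot>\<^sub>v (N * A *\<^sub>v x)"
    using A M(2) x by (simp add: assoc_mult_mat_vec[of N d d A d] mult_mat_vec[of _ d d])
  have eq: "((1 / s) \<cdot>\<^sub>v (N * A *\<^sub>v x)) \<bullet> ((1 / s) \<cdot>\<^sub>v (N * A *\<^sub>v x))
      = ((N * A *\<^sub>v x) \<bullet> (N * A *\<^sub>v x)) / s\<^sup>2"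
  proof -
    have "N * A *\<^sub>v x \<in> carrier_vec d" using A M(2) x by (intro mult_mat_vec_carrier[of _ d d]) auto
    then show ?thesis by (simp add: power2_eq_square)
  qed
  show ?thesis using le xx unfolding NAz eq s(2) by (simp add: divide_le_eq)
qed

text \<open>In the coordinates in which the old ellipsoid is the unit ball and the new point is \<open>s u\<close> with
  \<open>u\<close> a unit vector, the optimal ellipsoid stretches the direction \<open>u\<close> by \<open>\<rho> = max 1 s\<close>. Any competitor
  induces a contraction \<open>V\<close> with \<open>\<rho> |V u| \<le> 1\<close>, which bounds the Frobenius norm of the stretched
  \<open>V\<close> by the dimension.\<close>

lemma min_ellipsoid_insert:
  assumes A: "A \<in> carrier_mat d d" "invertible_mat A" and p: "p \<in> carrier_vec d" and d: "1 \<le> d"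
  obtains A' c where "A' \<in> carrier_mat d d" "invertible_mat A'" "0 \<le> c"
    "min_ellipsoid d (insert p (ell d A)) = ell d A'" "insert p (ell d A) \<subseteq> ell d A'"
    "\<And>w. w \<in> carrier_vec d \<Longrightarrow> A' * A'\<^sup>T *\<^sub>v w = A * A\<^sup>T *\<^sub>v w + (c * (p \<bullet> w)) \<cdot>\<^sub>v p"
    "fro A' = fro A + c * (p \<bullet> p)" "ln ((det A)\<^sup>2) + c \<le> ln ((det A')\<^sup>2)"
proof -
  obtain N where N: "N \<in> carrier_mat d d" "A * N = 1\<^sub>m d" "N * A = 1\<^sub>m d"
    using inverse_mat_exists[OF A(2,1)] .
  define y where "y = N *\<^sub>v p"
  have y: "y \<in> carrier_vec d" using N(1) p by (simp add: y_def)
  have Ay: "A *\<^sub>v y = p" unfolding y_def by (rule mult_mat_vec_inverse[OF A(1) N(1,2) p])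
  define s where "s = sqrt (y \<bullet> y)"
  have s: "0 \<le> s" "s\<^sup>2 = y \<bullet> y" using scalar_prod_self_nonneg[of y] by (auto simp: s_def)
  \<comment> \<open>For \<open>y = 0\<close> any unit direction will do, and
    \<open>1 \<le> d\<close> supplies one.\<close>
  obtain u where u: "u \<in> carrier_vec d" "u \<bullet> u = 1" and yu: "y = s \<cdot>\<^sub>v u"
  proof (cases "y = 0\<^sub>v d")
    case True
    then have "s = 0" by (simp add: s_def)
    then have "y = s \<cdot>\<^sub>v unit_vec d 0" unfolding True by (intro eq_vecI) auto
    then show ?thesis using d by (intro that[of "unit_vec d 0"]) auto
  next
    case False
    then have "s \<noteq> 0" using scalar_prod_self_pos[OF y False] by (simp add: s_def)
    then have "y = s \<cdot>\<^sub>v ((1 / s) \<cdot>\<^sub>v y)" by (simp add: smult_smult_assoc)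
    moreover have "((1 / s) \<cdot>\<^sub>v y) \<bullet> ((1 / s) \<cdot>\<^sub>v y) = 1"
      using y \<open>s \<noteq> 0\<close> by (simp add: s(2)[symmetric] power2_eq_square)
    ultimately show ?thesis using y by (intro that[of "(1 / s) \<cdot>\<^sub>v y"]) auto
  qed
  define \<rho> where "\<rho> = max 1 s"
  have \<rho>: "1 \<le> \<rho>" "s \<le> \<rho>" by (auto simp: \<rho>_def)
  \<comment> \<open>This is the share of the squared \<open>u\<close>-component that is lost under
    \<open>J\<close>, the inverse of the stretch \<open>K\<close>. It is 0 exactly when the point
    already lies in the ellipsoid.\<close>
  define c where "c = 1 - 1 / \<rho>\<^sup>2"
  have c: "0 \<le> c" using \<rho>(1) by (simp add: c_def)
  define K where "K = stretch d u (\<rho> - 1)"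
  define J where "J = stretch d u (1 / \<rho> - 1)"
  have KJ_carrier: "K \<in> carrier_mat d d" "J \<in> carrier_mat d d" by (auto simp: K_def J_def)
  have KJ: "K * J = 1\<^sub>m d"
  proof -
    have "\<rho> - 1 + (1 / \<rho> - 1) + (\<rho> - 1) * (1 / \<rho> - 1) = 0" using \<rho>(1) by (simp add: field_simps)
    then show ?thesis unfolding K_def J_def stretch_mult_stretch[OF u] by (simp add: stretch_zero)
  qed
  have J_norm: "(J *\<^sub>v x) \<bullet> (J *\<^sub>v x) = x \<bullet> x - c * (x \<bullet> u)\<^sup>2" if "x \<in> carrier_vec d" for x
    unfolding J_def stretch_vec_norm[OF u that]
    using \<rho>(1) by (simp add: c_def power2_eq_square field_simps)
  define A' where "A' = A * K"
  have A': "A' \<in> carrier_mat d d" using A KJ_carrier by (simp add: A'_def)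
  have JN: "J * N \<in> carrier_mat d d" using N KJ_carrier by simp
  have inv: "A' * (J * N) = 1\<^sub>m d"
  proof -
    have "A' * (J * N) = A * (K * J) * N"
      unfolding A'_def using A KJ_carrier N by (simp add: assoc_mult_mat[of _ d d _ d _ d])
    then show ?thesis unfolding KJ using A N by simp
  qed
  have A'_inv: "invertible_mat A'" by (rule invertible_matI[OF A' JN inv])
  have mem: "v \<in> ell d A' \<longleftrightarrow> v \<in> carrier_vec d \<and> (J *\<^sub>v (N *\<^sub>v v)) \<bullet> (J *\<^sub>v (N *\<^sub>v v)) \<le> 1" for v
    unfolding mem_ell_iff[OF A' JN inv]
    using assoc_mult_mat_vec[OF KJ_carrier(2) N(1), of v] by auto
  have "p \<in> ell d A'"
  proof -
    have "(J *\<^sub>v y) \<bullet> (J *\<^sub>v y) = s\<^sup>2 * (1 - c)"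
      unfolding J_norm[OF y] using u by (simp add: s(2)[symmetric] yu power2_eq_square algebra_simps)
    also have "\<dots> \<le> 1"
      using s(1) \<rho> by (simp add: c_def power_mono)
    finally show ?thesis unfolding mem using p by (simp add: y_def)
  qed
  moreover have "ell d A \<subseteq> ell d A'"
  proof
    fix v assume "v \<in> ell d A"
    then have v: "v \<in> carrier_vec d" "(N *\<^sub>v v) \<bullet> (N *\<^sub>v v) \<le> 1"
      unfolding mem_ell_iff[OF A(1) N(1,2)] by auto
    have "(J *\<^sub>v (N *\<^sub>v v)) \<bullet> (J *\<^sub>v (N *\<^sub>v v)) \<le> (N *\<^sub>v v) \<bullet> (N *\<^sub>v v)"
      using J_norm[of "N *\<^sub>v v"] N(1) v(1) c by simp
    then show "v \<in> ell d A'" unfolding mem using v by linarith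
  qed
  ultimately have sub: "insert p (ell d A) \<subseteq> ell d A'" by blast
  have "min_ellipsoid d (insert p (ell d A)) = ell d A'"
  proof (rule min_ellipsoid_eqI[OF A' A'_inv sub])
    fix M B assume M: "M \<in> carrier_mat d d" "B \<in> carrier_mat d d" "M * B = 1\<^sub>m d" "B * M = 1\<^sub>m d"
      and pM: "insert p (ell d A) \<subseteq> ell d M"
    define V where "V = B * A"
    have V: "V \<in> carrier_mat d d" using M(2) A(1) by (simp add: V_def)
    have contr: "(V *\<^sub>v x) \<bullet> (V *\<^sub>v x) \<le> x \<bullet> x" if "x \<in> carrier_vec d" for x
      unfolding V_def by (rule contraction_of_ell_subset[OF A(1) M(1-3) _ that]) (use pM in blast)
    let ?q = "(V *\<^sub>v u) \<bullet> (V *\<^sub>v u)"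
    \<comment> \<open>Without a stretch this is the contraction property; otherwise \<rho> = s and
      it expresses that the competitor contains \<open>p\<close>, whose image under \<open>B\<close>
      is s times V u.\<close>
    have q: "\<rho>\<^sup>2 * ?q \<le> 1"
    proof (cases "s \<le> 1")
      case True
      then show ?thesis using contr[OF u(1)] u(2) by (simp add: \<rho>_def)
    next
      case False
      have Vu: "V *\<^sub>v u \<in> carrier_vec d" using V u by simp
      have "B *\<^sub>v p = V *\<^sub>v y"
        unfolding V_def Ay[symmetric] using M(2) A(1) y by simp
      also have "\<dots> = s \<cdot>\<^sub>v (V *\<^sub>v u)" unfolding yu by (rule mult_mat_vec[OF V u(1)])
      finally have "(s \<cdot>\<^sub>v (V *\<^sub>v u)) \<bullet> (s \<cdot>\<^sub>v (V *\<^sub>v u)) \<le> 1"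
        using pM mem_ell_iff[OF M(1-3), of p] by simp
      then show ?thesis using False Vu by (simp add: \<rho>_def power2_eq_square mult.assoc)
    qed
    \<comment> \<open>\<open>stretch d u (-1)\<close> is the projection onto the complement of
      \<open>u\<close>, with \<open>fro\<close> equal to d - 1. Composing it with the contraction
      \<open>V\<close> does not increase \<open>fro\<close> and removes exactly the term
      \<open>?q\<close>.\<close>
    have "fro V - ?q \<le> real d - 1"
      using fro_contraction[OF V stretch_carrier contr, of u "-1"]
        fro_mult_stretch[OF V u, of "-1"] fro_stretch[OF u, of "-1"] by simp
    moreover have "fro (B * A') = fro V + (\<rho>\<^sup>2 - 1) * ?q"
    proof -
      have "B * A' = V * K" unfolding A'_def V_def using M(2) A(1) KJ_carrier by simp
      moreover have "2 * (\<rho> - 1) + (\<rho> - 1)\<^sup>2 = \<rho>\<^sup>2 - 1" by (simp add: power2_eq_square algebra_simps)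
      ultimately show ?thesis unfolding K_def using fro_mult_stretch[OF V u, of "\<rho> - 1"] by simp
    qed
    ultimately show "fro (B * A') \<le> d" using q by (simp add: algebra_simps)
  qed
  moreover define Au where "Au = A *\<^sub>v u"
  have Au: "Au \<in> carrier_vec d" using A u by (simp add: Au_def)
  have pAu: "p = s \<cdot>\<^sub>v Au" unfolding Ay[symmetric] yu Au_def by (rule mult_mat_vec[OF A(1) u(1)])
  \<comment> \<open>Since p = s A u, this rewrites the rank-one change (\<rho>^2 - 1)(Au)(Au)^T as c
    p p^T. For \<rho> = 1 it may fail to have \<rho> = s, but then both coefficients are 0.\<close>
  have cs: "c * s\<^sup>2 = \<rho>\<^sup>2 - 1"
    if "1 < \<rho>" using that by (simp add: c_def \<rho>_def max_def field_simps split: if_splits)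
  have c0: "c = 0 \<and> \<rho>\<^sup>2 - 1 = 0" if "\<not> 1 < \<rho>" using that \<rho> by (simp add: c_def)
  have cs': "c * s * s = \<rho>\<^sup>2 - 1 \<or> c = 0 \<and> \<rho>\<^sup>2 - 1 = 0"
    using cs c0 by (auto simp: power2_eq_square mult.assoc)
  have gram: "A' * A'\<^sup>T *\<^sub>v w = A * A\<^sup>T *\<^sub>v w + (c * (p \<bullet> w)) \<cdot>\<^sub>v p" if w: "w \<in> carrier_vec d" for w
  proof -
    let ?x = "A\<^sup>T *\<^sub>v w"
    have x: "?x \<in> carrier_vec d" using A w by simp
    have "\<rho> - 1 + (\<rho> - 1) + (\<rho> - 1) * (\<rho> - 1) = \<rho>\<^sup>2 - 1" by (simp add: power2_eq_square algebra_simps)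
    then have KK: "K * K\<^sup>T = stretch d u (\<rho>\<^sup>2 - 1)"
      unfolding K_def stretch_transpose stretch_mult_stretch[OF u] by (rule arg_cong)
    have "A' * A'\<^sup>T = A * (K * K\<^sup>T) * A\<^sup>T"
      unfolding A'_def using A KJ_carrier
      by (simp add: transpose_mult[of _ d d _ d] assoc_mult_mat[of _ d d _ d _ d])
    then have "A' * A'\<^sup>T *\<^sub>v w = A *\<^sub>v (stretch d u (\<rho>\<^sup>2 - 1) *\<^sub>v ?x)"
      unfolding KK using A w by (simp add: assoc_mult_mat_vec[of _ d d _ d])
    also have "\<dots> = A *\<^sub>v ?x + ((\<rho>\<^sup>2 - 1) * (?x \<bullet> u)) \<cdot>\<^sub>v Au"
      unfolding stretch_mult_vec[OF u(1) x] Au_def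
      using A(1) x u by (simp add: mult_add_distrib_mat_vec[of _ d d] mult_mat_vec[of _ d d])
    also have "?x \<bullet> u = Au \<bullet> w"
      unfolding Au_def scalar_prod_transpose[OF A(1) u(1) w] using comm_scalar_prod[OF x u(1)] .
    also have "((\<rho>\<^sup>2 - 1) * (Au \<bullet> w)) \<cdot>\<^sub>v Au = (c * (p \<bullet> w)) \<cdot>\<^sub>v p"
      using cs' Au w unfolding pAu by (auto simp: smult_smult_assoc mult_ac)
    finally show ?thesis using A w by simp
  qed
  moreover have "fro A' = fro A + c * (p \<bullet> p)"
  proof -
    have "2 * (\<rho> - 1) + (\<rho> - 1)\<^sup>2 = \<rho>\<^sup>2 - 1" by (simp add: power2_eq_square algebra_simps)
    then have "fro A' = fro A + (\<rho>\<^sup>2 - 1) * (Au \<bullet> Au)"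
      unfolding A'_def K_def Au_def using fro_mult_stretch[OF A(1) u, of "\<rho> - 1"] by simp
    also have "(\<rho>\<^sup>2 - 1) * (Au \<bullet> Au) = c * (p \<bullet> p)"
      using cs' Au unfolding pAu by (auto simp: mult_ac)
    finally show ?thesis .
  qed
  \<comment> \<open>AM-GM at scale 1 is applied to the inverse \<open>J\<close>:
    \<open>fro J = d - c\<close> gives ln (det J)^2 <= -c, and the potential grows by the negative
    of that logarithm. No determinant has to be computed.\<close>
  moreover have "ln ((det A)\<^sup>2) + c \<le> ln ((det A')\<^sup>2)"
  proof -
    have J_inv: "invertible_mat J"
      by (rule invertible_matI[OF KJ_carrier(2,1) mat_mult_left_right_inverse[OF KJ_carrier KJ]])
    have fJ: "fro J = d - c"
      unfolding J_def fro_stretch[OF u] by (simp add: c_def power2_eq_square algebra_simps)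
    have lJ: "ln ((det J)\<^sup>2) \<le> - c"
      using ln_det_sq_le[OF KJ_carrier(2) J_inv, of 1] fJ by simp
    have dKJ: "det K * det J = 1" using det_mult[OF KJ_carrier] KJ by simp
    then have nz: "det K \<noteq> 0" "det J \<noteq> 0" by auto
    have "(det K)\<^sup>2 * (det J)\<^sup>2 = 1" unfolding power_mult_distrib[symmetric] dKJ by simp
    then have "ln ((det K)\<^sup>2) + ln ((det J)\<^sup>2) = 0"
      using ln_mult[of "(det K)\<^sup>2" "(det J)\<^sup>2"] nz by simp
    moreover have "ln ((det A')\<^sup>2) = ln ((det A)\<^sup>2) + ln ((det K)\<^sup>2)"
      unfolding A'_def det_mult[OF A(1) KJ_carrier(1)] power_mult_distrib
      using invertible_mat_iff_det[OF A(1)] A(2) nz ln_mult[of "(det A)\<^sup>2" "(det K)\<^sup>2"] by simp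
    ultimately show ?thesis using lJ by linarith
  qed
  ultimately show thesis using that[OF A' A'_inv c] sub by blast
qed

section \<open>The state of the algorithm and the symmetric hull\<close>

lemma ell_scaled_one:
  fixes d :: nat and r :: real
  assumes r: "0 < r"
  defines "A \<equiv> r \<cdot>\<^sub>m 1\<^sub>m d"
  shows "A \<in> carrier_mat d d" "invertible_mat A" "ell d A = centered_ball d r"
    "w \<in> carrier_vec d \<Longrightarrow> A * A\<^sup>T *\<^sub>v w = r\<^sup>2 \<cdot>\<^sub>v w" "fro A = d * r\<^sup>2" "ln ((det A)\<^sup>2) = d * ln (r\<^sup>2)"
proof -
  show A: "A \<in> carrier_mat d d" by (simp add: A_def)
  define N where "N = (1 / r) \<cdot>\<^sub>m (1\<^sub>m d :: real mat)"
  have N: "N \<in> carrier_mat d d" by (simp add: N_def)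
  have AN: "A * N = 1\<^sub>m d"
    using r by (intro eq_matI) (auto simp: A_def N_def)
  show "invertible_mat A" by (rule invertible_matI[OF A N AN])
  have Av: "(a \<cdot>\<^sub>m 1\<^sub>m d) *\<^sub>v v = a \<cdot>\<^sub>v v" if "v \<in> carrier_vec d" for a :: real and v
    using that by (intro eq_vecI) auto
  have "v \<in> ell d A \<longleftrightarrow> v \<in> centered_ball d r" for v
  proof (cases "v \<in> carrier_vec d")
    case True
    then have "(N *\<^sub>v v) \<bullet> (N *\<^sub>v v) = (v \<bullet> v) / r\<^sup>2"
      unfolding N_def by (simp add: Av power2_eq_square)
    moreover have "v \<bullet> v \<le> r\<^sup>2 \<longleftrightarrow> sqrt (v \<bullet> v) \<le> r"
      using r by (metis abs_of_pos real_sqrt_abs real_sqrt_le_iff)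
    moreover have "v \<in> centered_ball d r \<longleftrightarrow> sqrt (v \<bullet> v) \<le> r"
      using True by (simp add: centered_ball_def vec_len_def)
    ultimately show ?thesis
      unfolding mem_ell_iff[OF A N AN] using r True by (simp add: divide_le_eq)
  next
    case False
    then show ?thesis unfolding mem_ell_iff[OF A N AN] by (simp add: centered_ball_def)
  qed
  then show "ell d A = centered_ball d r" by blast
  have AA: "A * A\<^sup>T = r\<^sup>2 \<cdot>\<^sub>m 1\<^sub>m d"
    by (rule eq_matI) (auto simp: A_def power2_eq_square)
  show "A * A\<^sup>T *\<^sub>v w = r\<^sup>2 \<cdot>\<^sub>v w" if "w \<in> carrier_vec d" unfolding AA by (rule Av[OF that])
  show "fro A = d * r\<^sup>2" unfolding fro_gram[OF A] AA by simp
  have "det A = r ^ d" by (simp add: A_def)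
  then have "(det A)\<^sup>2 = (r\<^sup>2) ^ d" by (simp add: power_mult[symmetric] mult.commute)
  then show "ln ((det A)\<^sup>2) = d * ln (r\<^sup>2)" using r by (simp add: ln_realpow)
qed

text \<open>Each step contributes one coefficient, and earlier points stay inside because the
  ellipsoids grow. The Gram identity is stated by its action on vectors, coordinate by coordinate,
  so that only sums of reals occur.\<close>

lemma stream_invariant:
  assumes d: "1 \<le> d" and r: "0 < r" and "\<forall>s\<in>{1..t}. x s \<in> carrier_vec d"
  shows "\<exists>A c. A \<in> carrier_mat d d \<and> invertible_mat A \<and> stream_ellipsoid d r x t = ell d A \<and>
    (\<forall>s\<in>{1..t}. 0 \<le> c s \<and> x s \<in> ell d A) \<and>
    (\<forall>w\<in>carrier_vec d. \<forall>i<d. (A * A\<^sup>T *\<^sub>v w) $ i = r\<^sup>2 * w $ i + (\<Sum>s\<in>{1..t}. c s * (x s \<bullet> w) * x s $ i)) \<and>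
    fro A = d * r\<^sup>2 + (\<Sum>s\<in>{1..t}. c s * (x s \<bullet> x s)) \<and>
    d * ln (r\<^sup>2) + (\<Sum>s\<in>{1..t}. c s) \<le> ln ((det A)\<^sup>2)"
  using assms(3)
proof (induction t)
  case 0
  show ?case
    by (intro exI[of _ "r \<cdot>\<^sub>m 1\<^sub>m d"] exI[of _ "\<lambda>_. 0"]) (simp add: ell_scaled_one[OF r] del: det_smult)
next
  case (Suc t)
  have "\<forall>s\<in>{1..t}. x s \<in> carrier_vec d" using Suc.prems by simp
  from Suc.IH[OF this] obtain A c
    where A: "A \<in> carrier_mat d d" "invertible_mat A" "stream_ellipsoid d r x t = ell d A"
    and c: "\<forall>s\<in>{1..t}. 0 \<le> c s \<and> x s \<in> ell d A"
    and gram: "\<forall>w\<in>carrier_vec d. \<forall>i<d.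
      (A * A\<^sup>T *\<^sub>v w) $ i = r\<^sup>2 * w $ i + (\<Sum>s\<in>{1..t}. c s * (x s \<bullet> w) * x s $ i)"
    and fro: "fro A = d * r\<^sup>2 + (\<Sum>s\<in>{1..t}. c s * (x s \<bullet> x s))"
    and lndet: "d * ln (r\<^sup>2) + (\<Sum>s\<in>{1..t}. c s) \<le> ln ((det A)\<^sup>2)"
    by (elim exE conjE)
  let ?p = "x (Suc t)"
  have p: "?p \<in> carrier_vec d" using Suc.prems by simp
  obtain A' b where A': "A' \<in> carrier_mat d d" "invertible_mat A'" "0 \<le> b"
    "min_ellipsoid d (insert ?p (ell d A)) = ell d A'" "insert ?p (ell d A) \<subseteq> ell d A'"
    "\<And>w. w \<in> carrier_vec d \<Longrightarrow> A' * A'\<^sup>T *\<^sub>v w = A * A\<^sup>T *\<^sub>v w + (b * (?p \<bullet> w)) \<cdot>\<^sub>v ?p"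
    "fro A' = fro A + b * (?p \<bullet> ?p)" "ln ((det A)\<^sup>2) + b \<le> ln ((det A')\<^sup>2)"
    by (rule min_ellipsoid_insert[OF A(1,2) p d]) blast
  define c' where "c' = c(Suc t := b)"
  have sum: "(\<Sum>s\<in>{1..Suc t}. c' s * f s) = (\<Sum>s\<in>{1..t}. c s * f s) + b * f (Suc t)" for f
  proof -
    have "(\<Sum>s\<in>{1..t}. c' s * f s) = (\<Sum>s\<in>{1..t}. c s * f s)"
      by (rule sum.cong) (auto simp: c'_def)
    then show ?thesis by (simp add: c'_def)
  qed
  have "stream_ellipsoid d r x (Suc t) = ell d A'" using A(3) A'(4) by simp
  moreover have "\<forall>s\<in>{1..Suc t}. 0 \<le> c' s \<and> x s \<in> ell d A'"
  proof
    fix s assume "s \<in> {1..Suc t}"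
    then consider "s = Suc t" | "s \<in> {1..t}" "s \<noteq> Suc t" by force
    then show "0 \<le> c' s \<and> x s \<in> ell d A'"
      using A'(3,5) bspec[OF c, of s] by cases (auto simp: c'_def)
  qed
  moreover have "\<forall>w\<in>carrier_vec d. \<forall>i<d. (A' * A'\<^sup>T *\<^sub>v w) $ i
      = r\<^sup>2 * w $ i + (\<Sum>s\<in>{1..Suc t}. c' s * (x s \<bullet> w) * x s $ i)"
    unfolding mult.assoc[of "c' _"] sum
    using p by (auto simp: A'(6) gram mult.assoc simp del: index_mult_mat_vec)
  moreover have "fro A' = d * r\<^sup>2 + (\<Sum>s\<in>{1..Suc t}. c' s * (x s \<bullet> x s))"
    unfolding sum A'(7) fro by simp
  moreover have "d * ln (r\<^sup>2) + (\<Sum>s\<in>{1..Suc t}. c' s) \<le> ln ((det A')\<^sup>2)"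
    using sum[of "\<lambda>_. 1"] lndet A'(8) by simp
  ultimately show ?case using A'(1,2) by blast
qed

lemma symmetric_hullI:
  assumes n: "1 \<le> n" and x: "\<forall>t\<in>{1..n}. x t \<in> carrier_vec d"
    and a: "(\<Sum>t\<in>{1..n}. \<bar>a t\<bar>) \<le> 1"
  shows "Matrix.vec d (\<lambda>i. \<Sum>t\<in>{1..n}. a t * x t $ i) \<in> symmetric_hull d x n"
proof -
  let ?I = "{1..n} \<times> (UNIV :: bool set)"
  define \<phi> where "\<phi> = (\<lambda>(t, b). if b then x t else - x t)"
  define e where "e = (1 - (\<Sum>t\<in>{1..n}. \<bar>a t\<bar>)) / (2 * real n)"
  define \<omega> where "\<omega> = (\<lambda>(t, b). max 0 (if b then a t else - a t) + e)"
  \<comment> \<open>Weights in the hull are attached to points, not to indices, so the weights of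
    coinciding signed points are added up.\<close>
  define c where "c = (\<lambda>w. \<Sum>k\<in>{k\<in>?I. \<phi> k = w}. \<omega> k)"
  have e: "0 \<le> e" "2 * real n * e = 1 - (\<Sum>t\<in>{1..n}. \<bar>a t\<bar>)" using a n by (auto simp: e_def)
  have sum_pairs: "(\<Sum>k\<in>?I. f k) = (\<Sum>t\<in>{1..n}. f (t, True) + f (t, False))" for f :: "_ \<Rightarrow> real"
  proof -
    have "(\<Sum>k\<in>?I. f k) = (\<Sum>t\<in>{1..n}. \<Sum>b\<in>UNIV. f (t, b))" by (simp add: sum.cartesian_product)
    then show ?thesis by (simp add: UNIV_bool add.commute)
  qed
  have group: "(\<Sum>w\<in>\<phi> ` ?I. c w * g w) = (\<Sum>k\<in>?I. \<omega> k * g (\<phi> k))" for g :: "_ \<Rightarrow> real"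
  proof -
    have "(\<Sum>w\<in>\<phi> ` ?I. c w * g w) = (\<Sum>w\<in>\<phi> ` ?I. \<Sum>k\<in>{k\<in>?I. \<phi> k = w}. \<omega> k * g (\<phi> k))"
      unfolding c_def sum_distrib_right by (intro sum.cong) auto
    also have "\<dots> = (\<Sum>k\<in>?I. \<omega> k * g (\<phi> k))" by (rule sum.image_gen[symmetric]) simp
    finally show ?thesis .
  qed
  have c_nonneg: "0 \<le> c w" for w
    unfolding c_def using e(1) by (intro sum_nonneg) (auto simp: \<omega>_def)
  have c_sum: "(\<Sum>w\<in>\<phi> ` ?I. c w) = 1"
  proof -
    have "(\<Sum>w\<in>\<phi> ` ?I. c w) = (\<Sum>t\<in>{1..n}. \<bar>a t\<bar> + 2 * e)"
      using group[of "\<lambda>_. 1"] unfolding sum_pairs by (simp add: \<omega>_def) (intro sum.cong, auto)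
    also have "\<dots> = 1" using e(2) by (simp add: sum.distrib)
    finally show ?thesis .
  qed
  have v_eq: "Matrix.vec d (\<lambda>i. \<Sum>t\<in>{1..n}. a t * x t $ i) = Matrix.vec d (\<lambda>i. \<Sum>w\<in>\<phi> ` ?I. c w * w $ i)"
  proof (rule eq_vecI)
    fix i assume "i < dim_vec (Matrix.vec d (\<lambda>i. \<Sum>w\<in>\<phi> ` ?I. c w * w $ i))"
    then have i: "i < d" by simp
    have "a t * x t $ i = \<omega> (t, True) * \<phi> (t, True) $ i + \<omega> (t, False) * \<phi> (t, False) $ i"
      if "t \<in> {1..n}" for t
    proof -
      have "x t \<in> carrier_vec d" using x that by blast
      then have "i < dim_vec (x t)" using i by simp
      then show ?thesis by (auto simp: \<omega>_def \<phi>_def max_def algebra_simps)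
    qed
    then show "Matrix.vec d (\<lambda>i. \<Sum>t\<in>{1..n}. a t * x t $ i) $ i
        = Matrix.vec d (\<lambda>i. \<Sum>w\<in>\<phi> ` ?I. c w * w $ i) $ i"
      unfolding group sum_pairs using i by simp
  qed simp
  have "\<phi> (t, b) \<in> {x t, - x t}" for t b by (simp add: \<phi>_def)
  then have sub: "\<phi> ` ?I \<subseteq> (\<Union>t\<in>{1..n}. {x t, - x t})" by blast
  show ?thesis
    unfolding symmetric_hull_def convex_hull_vec_def v_eq
    by (intro CollectI exI[of _ "\<phi> ` ?I"] exI[of _ c] conjI ballI sub c_nonneg c_sum refl) simp
qed

text \<open>Converse of \<open>symmetric_hullI\<close>: the hull is the image of the l1 unit ball of
  coefficients. Each point of the combination is assigned one index and one sign; opposite signs may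
  cancel, hence only an inequality.\<close>

lemma symmetric_hullE:
  assumes v: "v \<in> symmetric_hull d x n" and x: "\<forall>t\<in>{1..n}. x t \<in> carrier_vec d"
  obtains a where "(\<Sum>t\<in>{1..n}. \<bar>a t\<bar>) \<le> 1" "v = Matrix.vec d (\<lambda>i. \<Sum>t\<in>{1..n}. a t * x t $ i)"
proof -
  obtain T c where T: "finite T" "T \<subseteq> (\<Union>t\<in>{1..n}. {x t, - x t})" "\<forall>w\<in>T. 0 \<le> c w" "(\<Sum>w\<in>T. c w) = 1"
    and vT: "v = Matrix.vec d (\<lambda>i. \<Sum>w\<in>T. c w * w $ i)"
    using v unfolding symmetric_hull_def convex_hull_vec_def by blast
  have ex: "\<forall>w\<in>T. \<exists>k. fst k \<in> {1..n} \<and> \<bar>snd k\<bar> = (1 :: real) \<and> (\<forall>i<d. w $ i = snd k * x (fst k) $ i)"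
  proof
    fix w assume "w \<in> T"
    then obtain t where t: "t \<in> {1..n}" "w = x t \<or> w = - x t" using T(2) by blast
    then show "\<exists>k. fst k \<in> {1..n} \<and> \<bar>snd k\<bar> = (1 :: real) \<and> (\<forall>i<d. w $ i = snd k * x (fst k) $ i)"
      using bspec[OF x t(1)] by (intro exI[of _ "(t, if w = x t then 1 else - 1)"]) auto
  qed
  from bchoice[OF ex] obtain k where "\<forall>w\<in>T. fst (k w) \<in> {1..n} \<and> \<bar>snd (k w)\<bar> = (1 :: real) \<and>
      (\<forall>i<d. w $ i = snd (k w) * x (fst (k w)) $ i)"
    by (elim exE)
  then have k: "\<And>w. w \<in> T \<Longrightarrow> fst (k w) \<in> {1..n}" "\<And>w. w \<in> T \<Longrightarrow> \<bar>snd (k w)\<bar> = (1 :: real)"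
    "\<And>w i. w \<in> T \<Longrightarrow> i < d \<Longrightarrow> w $ i = snd (k w) * x (fst (k w)) $ i" by blast+
  define a where "a = (\<lambda>t. \<Sum>w\<in>{w\<in>T. fst (k w) = t}. snd (k w) * c w)"
  have group: "(\<Sum>t\<in>{1..n}. \<Sum>w\<in>{w\<in>T. fst (k w) = t}. f w) = (\<Sum>w\<in>T. f w)" for f :: "_ \<Rightarrow> real"
    by (rule sum.group) (use T(1) k(1) in auto)
  have "(\<Sum>t\<in>{1..n}. \<bar>a t\<bar>) \<le> (\<Sum>t\<in>{1..n}. \<Sum>w\<in>{w\<in>T. fst (k w) = t}. c w)"
  proof (rule sum_mono)
    fix t
    have "\<bar>a t\<bar> \<le> (\<Sum>w\<in>{w\<in>T. fst (k w) = t}. \<bar>snd (k w) * c w\<bar>)"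
      unfolding a_def by (rule sum_abs)
    also have "\<dots> = (\<Sum>w\<in>{w\<in>T. fst (k w) = t}. c w)"
      by (rule sum.cong) (use k(2) T(3) in \<open>auto simp: abs_mult\<close>)
    finally show "\<bar>a t\<bar> \<le> (\<Sum>w\<in>{w\<in>T. fst (k w) = t}. c w)" .
  qed
  also have "\<dots> = 1" unfolding group by (rule T(4))
  finally have le: "(\<Sum>t\<in>{1..n}. \<bar>a t\<bar>) \<le> 1" .
  have "(\<Sum>t\<in>{1..n}. a t * x t $ i) = (\<Sum>w\<in>T. c w * w $ i)" if i: "i < d" for i
  proof -
    have "(\<Sum>t\<in>{1..n}. a t * x t $ i) = (\<Sum>t\<in>{1..n}. \<Sum>w\<in>{w\<in>T. fst (k w) = t}. c w * w $ i)"
      unfolding a_def sum_distrib_right by (intro sum.cong) (auto simp: k(3)[OF _ i])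
    then show ?thesis unfolding group .
  qed
  then have "v = Matrix.vec d (\<lambda>i. \<Sum>t\<in>{1..n}. a t * x t $ i)"
    unfolding vT by (intro eq_vecI) auto
  then show thesis using that le by blast
qed

section \<open>The approximation guarantee\<close>

lemma scalar_prod_Cauchy_Schwarz:
  assumes "u \<in> carrier_vec d" "v \<in> carrier_vec d"
  shows "(u \<bullet> v)\<^sup>2 \<le> (u \<bullet> u) * (v \<bullet> (v :: real Matrix.vec))"
  using assms Cauchy_Schwarz_ineq_sum[of "\<lambda>i. u $ i" "\<lambda>i. v $ i" "{0..<d}"]
  unfolding scalar_prod_self_eq by (simp add: scalar_prod_def)

lemma scalar_prod_combination:
  assumes "z \<in> carrier_vec d" "\<forall>t\<in>I. x t \<in> carrier_vec d"
  shows "Matrix.vec d (\<lambda>i. \<Sum>t\<in>I. a t * x t $ i) \<bullet> z = (\<Sum>t\<in>I. a t * (x t \<bullet> (z :: real Matrix.vec)))"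
proof -
  have "Matrix.vec d (\<lambda>i. \<Sum>t\<in>I. a t * x t $ i) \<bullet> z = (\<Sum>i\<in>{0..<d}. \<Sum>t\<in>I. a t * (x t $ i * z $ i))"
    using assms(1) by (simp add: scalar_prod_def sum_distrib_right mult.assoc)
  also have "\<dots> = (\<Sum>t\<in>I. \<Sum>i\<in>{0..<d}. a t * (x t $ i * z $ i))" by (rule sum.swap)
  also have "\<dots> = (\<Sum>t\<in>I. a t * (x t \<bullet> z))"
    using assms by (simp add: scalar_prod_def sum_distrib_left)
  finally show ?thesis .
qed

text \<open>Convexity of the norm, obtained by pairing q = B v with itself: |q|^2 is a combination
  of the products of \<open>B *\<^sub>v x t\<close> with \<open>q\<close>, each at most R |q|. It is
  used with an inverse for \<open>B\<close> to place the hull in the ellipsoid, and with the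
  identity to compare \<open>r\<close> with \<open>R\<close>.\<close>

lemma combination_norm_le:
  assumes B: "(B :: real mat) \<in> carrier_mat d d" and x: "\<forall>t\<in>I. x t \<in> carrier_vec d"
    and a: "(\<Sum>t\<in>I. \<bar>a t\<bar>) \<le> 1" and R: "0 \<le> R"
    and le: "\<forall>t\<in>I. (B *\<^sub>v x t) \<bullet> (B *\<^sub>v x t) \<le> R\<^sup>2"
    and v: "v = Matrix.vec d (\<lambda>i. \<Sum>t\<in>I. a t * x t $ i)"
  shows "(B *\<^sub>v v) \<bullet> (B *\<^sub>v v) \<le> R\<^sup>2"
proof -
  define q where "q = B *\<^sub>v v"
  have vc: "v \<in> carrier_vec d" by (simp add: v)
  have q: "q \<in> carrier_vec d" using B vc by (simp add: q_def)
  define g where "g = sqrt (q \<bullet> q)"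
  have g: "0 \<le> g" "g\<^sup>2 = q \<bullet> q" using scalar_prod_self_nonneg[of q] by (auto simp: g_def)
  have Bq: "B\<^sup>T *\<^sub>v q \<in> carrier_vec d" using B q by simp
  have "q \<bullet> q = v \<bullet> (B\<^sup>T *\<^sub>v q)"
    using scalar_prod_transpose[OF B vc q] unfolding q_def .
  also have "\<dots> = (\<Sum>t\<in>I. a t * (x t \<bullet> (B\<^sup>T *\<^sub>v q)))"
    unfolding v by (rule scalar_prod_combination[OF Bq x])
  also have "\<dots> \<le> (\<Sum>t\<in>I. \<bar>a t\<bar> * (R * g))"
  proof (rule sum_mono)
    fix t assume t: "t \<in> I"
    have xt: "x t \<in> carrier_vec d" using x t by blast
    have "((B *\<^sub>v x t) \<bullet> q)\<^sup>2 \<le> ((B *\<^sub>v x t) \<bullet> (B *\<^sub>v x t)) * (q \<bullet> q)"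
      by (rule scalar_prod_Cauchy_Schwarz[of _ d]) (use B xt q in auto)
    also have "\<dots> \<le> R\<^sup>2 * (q \<bullet> q)"
      using le t scalar_prod_self_nonneg[of q] by (intro mult_right_mono) auto
    also have "\<dots> = (R * g)\<^sup>2" by (simp add: g(2)[symmetric] power_mult_distrib)
    finally have "\<bar>(B *\<^sub>v x t) \<bullet> q\<bar> \<le> R * g"
      using R g(1) by (simp add: abs_le_square_iff[symmetric])
    then have "\<bar>x t \<bullet> (B\<^sup>T *\<^sub>v q)\<bar> \<le> R * g"
      unfolding scalar_prod_transpose[OF B xt q] .
    then have "\<bar>a t * (x t \<bullet> (B\<^sup>T *\<^sub>v q))\<bar> \<le> \<bar>a t\<bar> * (R * g)"
      unfolding abs_mult by (intro mult_left_mono) auto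
    then show "a t * (x t \<bullet> (B\<^sup>T *\<^sub>v q)) \<le> \<bar>a t\<bar> * (R * g)" by linarith
  qed
  also have "\<dots> \<le> 1 * (R * g)"
    unfolding sum_distrib_right[symmetric] using a R g(1) by (intro mult_right_mono) auto
  finally have "g * g \<le> R * g" unfolding g(2)[symmetric] by (simp add: power2_eq_square)
  then have "g \<le> R" using g(1) R by (cases "g = 0") auto
  then have "g\<^sup>2 \<le> R\<^sup>2" using g(1) by (intro power_mono) auto
  then show ?thesis unfolding g(2) q_def .
qed

lemma symmetric_hull_subset_ell:
  assumes A: "A \<in> carrier_mat d d" "invertible_mat A" and x: "\<forall>t\<in>{1..n}. x t \<in> carrier_vec d"
    and sub: "\<forall>t\<in>{1..n}. x t \<in> ell d A"
  shows "symmetric_hull d x n \<subseteq> ell d A"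
proof
  fix v assume "v \<in> symmetric_hull d x n"
  then obtain a where a: "(\<Sum>t\<in>{1..n}. \<bar>a t\<bar>) \<le> 1" "v = Matrix.vec d (\<lambda>i. \<Sum>t\<in>{1..n}. a t * x t $ i)"
    by (rule symmetric_hullE[OF _ x])
  obtain N where N: "N \<in> carrier_mat d d" "A * N = 1\<^sub>m d" "N * A = 1\<^sub>m d"
    using inverse_mat_exists[OF A(2,1)] .
  have "(N *\<^sub>v v) \<bullet> (N *\<^sub>v v) \<le> 1\<^sup>2"
    by (rule combination_norm_le[OF N(1) x a(1) _ _ a(2)])
      (use sub mem_ell_iff[OF A(1) N(1,2)] in auto)
  then show "v \<in> ell d A" unfolding mem_ell_iff[OF A(1) N(1,2)] using a(2) by simp
qed

text \<open>The ball contains a vector of length \<open>r\<close>, and hull points have length at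
  most \<open>R\<close>.\<close>

lemma radius_le_of_ball_subset_hull:
  assumes d: "1 \<le> d" and n: "1 \<le> n" and x: "\<forall>t\<in>{1..n}. x t \<in> carrier_vec d" and r: "0 < r"
    and ball: "centered_ball d r \<subseteq> symmetric_hull d x n"
    and R: "0 \<le> R" "\<forall>t\<in>{1..n}. x t \<bullet> x t \<le> R\<^sup>2"
  shows "r \<le> R"
proof -
  let ?v = "r \<cdot>\<^sub>v unit_vec d 0"
  have vv: "?v \<bullet> ?v = r\<^sup>2"
    using d by (simp add: power2_eq_square smult_scalar_prod_distrib[of _ d] scalar_prod_smult_distrib[of _ d])
  then have "?v \<in> centered_ball d r" using r by (simp add: centered_ball_def vec_len_def)
  then have "?v \<in> symmetric_hull d x n" using ball by blast
  then obtain a where a: "(\<Sum>t\<in>{1..n}. \<bar>a t\<bar>) \<le> 1" "?v = Matrix.vec d (\<lambda>i. \<Sum>t\<in>{1..n}. a t * x t $ i)"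
    by (rule symmetric_hullE[OF _ x])
  have "(1\<^sub>m d *\<^sub>v ?v) \<bullet> (1\<^sub>m d *\<^sub>v ?v) \<le> R\<^sup>2"
    by (rule combination_norm_le[OF one_carrier_mat x a(1) R(1) _ a(2)]) (use R(2) x in auto)
  then have "r\<^sup>2 \<le> R\<^sup>2" using vv by simp
  then show ?thesis using R(1) by (rule power2_le_imp_le)
qed

text \<open>Expands (\<alpha> y - 1)^2 >= 0. It stands in for Cauchy-Schwarz, splitting a linear
  term into a quadratic part and a constant.\<close>

lemma le_mean_of_scaling:
  assumes "0 < (\<alpha> :: real)"
  shows "y \<le> (\<alpha> * y\<^sup>2 + 1 / \<alpha>) / 2"
proof -
  have "0 \<le> (\<alpha> * y - 1)\<^sup>2 / \<alpha>" using assms by simp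
  also have "\<dots> = \<alpha> * y\<^sup>2 + 1 / \<alpha> - 2 * y" using assms by (simp add: power2_eq_square field_simps)
  finally show ?thesis by simp
qed

text \<open>A point \<open>v = A p\<close> of the ellipsoid equals \<open>A A\<^sup>T w\<close> with \<open>w = A\<^sup>-\<^sup>T p\<close>, and the formula for \<open>A A\<^sup>T\<close>
  expresses it through \<open>r w\<close>, which is \<open>|w|\<close> times a point of the ball of radius \<open>r\<close>, and the \<open>x\<^sub>s\<close>.
  The sum of the coefficients is controlled because \<open>r\<^sup>2 |w|\<^sup>2 + \<Sum> c\<^sub>s \<langle>x\<^sub>s, w\<rangle>\<^sup>2 = |p|\<^sup>2 \<le> 1\<close>.\<close>

lemma scaled_ell_subset_hull:
  assumes n: "1 \<le> n" and x: "\<forall>t\<in>{1..n}. x t \<in> carrier_vec d" and r: "0 < r"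
    and ball: "centered_ball d r \<subseteq> symmetric_hull d x n"
    and A: "A \<in> carrier_mat d d" "invertible_mat A" and c: "\<forall>s\<in>{1..n}. 0 \<le> c s"
    and gram: "\<forall>w\<in>carrier_vec d. \<forall>i<d.
      (A * A\<^sup>T *\<^sub>v w) $ i = r\<^sup>2 * w $ i + (\<Sum>s\<in>{1..n}. c s * (x s \<bullet> w) * x s $ i)"
    and \<alpha>: "\<alpha> = sqrt (1 + (\<Sum>s\<in>{1..n}. c s))"
  shows "(\<lambda>v. (1 / \<alpha>) \<cdot>\<^sub>v v) ` ell d A \<subseteq> symmetric_hull d x n"
proof (rule image_subsetI)
  fix v assume "v \<in> ell d A"
  then obtain p where p: "p \<in> carrier_vec d" "p \<bullet> p \<le> 1" and vp: "v = A *\<^sub>v p"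
    by (auto simp: mem_unit_ball)
  have S: "0 \<le> (\<Sum>s\<in>{1..n}. c s)" using c by (intro sum_nonneg) auto
  have \<alpha>: "0 < \<alpha>" "\<alpha>\<^sup>2 = 1 + (\<Sum>s\<in>{1..n}. c s)" unfolding \<alpha> using S by auto
  obtain N where N: "N \<in> carrier_mat d d" "A * N = 1\<^sub>m d" "N * A = 1\<^sub>m d"
    using inverse_mat_exists[OF A(2,1)] .
  define w where "w = N\<^sup>T *\<^sub>v p"
  have w: "w \<in> carrier_vec d" using N(1) p(1) by (simp add: w_def)
  have "A\<^sup>T * N\<^sup>T = 1\<^sub>m d" using transpose_mult[OF N(1) A(1)] N(3) by simp
  then have Aw: "A\<^sup>T *\<^sub>v w = p"
    unfolding w_def using mult_mat_vec_inverse[of "A\<^sup>T" d "N\<^sup>T" p] A(1) N(1) p(1) by simp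
  have vc: "v \<in> carrier_vec d" unfolding vp using A(1) p(1) by simp
  have "v = A * A\<^sup>T *\<^sub>v w"
    unfolding vp Aw[symmetric] using A(1) w assoc_mult_mat_vec[of A d d "A\<^sup>T" d w] by simp
  then have vi: "v $ i = r\<^sup>2 * w $ i + (\<Sum>s\<in>{1..n}. c s * (x s \<bullet> w) * x s $ i)" if "i < d" for i
    using gram w that by blast
  define y where "y = (\<lambda>s. x s \<bullet> w)"
  define g where "g = sqrt (w \<bullet> w)"
  have g: "0 \<le> g" "g\<^sup>2 = w \<bullet> w" using scalar_prod_self_nonneg[of w] by (auto simp: g_def)
  have vw: "v \<bullet> w = (r * g)\<^sup>2 + (\<Sum>s\<in>{1..n}. c s * (y s)\<^sup>2)"
  proof -
    have "v = r\<^sup>2 \<cdot>\<^sub>v w + Matrix.vec d (\<lambda>i. \<Sum>s\<in>{1..n}. (c s * y s) * x s $ i)"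
      using vc w by (intro eq_vecI) (auto simp: vi y_def)
    then have "v \<bullet> w = r\<^sup>2 * (w \<bullet> w) + Matrix.vec d (\<lambda>i. \<Sum>s\<in>{1..n}. (c s * y s) * x s $ i) \<bullet> w"
      using w by (simp add: add_scalar_prod_distrib[of _ d])
    also have "\<dots> = r\<^sup>2 * (w \<bullet> w) + (\<Sum>s\<in>{1..n}. (c s * y s) * (x s \<bullet> w))"
      unfolding scalar_prod_combination[OF w x] ..
    finally have "v \<bullet> w = r\<^sup>2 * (w \<bullet> w) + (\<Sum>s\<in>{1..n}. (c s * y s) * (x s \<bullet> w))" .
    then show ?thesis unfolding g(2)[symmetric] y_def by (simp add: power2_eq_square mult_ac)
  qed
  have "v \<bullet> w = p \<bullet> p"
    unfolding vp scalar_prod_transpose[OF A(1) p(1) w] Aw ..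
  then have le1: "(r * g)\<^sup>2 + (\<Sum>s\<in>{1..n}. c s * (y s)\<^sup>2) \<le> 1" using vw p(2) by simp
  \<comment> \<open>The multiple of \<open>w\<close> of length \<open>r\<close> lies in the ball,
    hence in the hull; \<open>b\<close> are its coefficients there.\<close>
  obtain b where b: "(\<Sum>t\<in>{1..n}. \<bar>b t\<bar>) \<le> 1"
    "\<And>i. i < d \<Longrightarrow> r * w $ i = g * (\<Sum>t\<in>{1..n}. b t * x t $ i)"
  proof (cases "w = 0\<^sub>v d")
    case True
    then show ?thesis by (intro that[of "\<lambda>_. 0"]) auto
  next
    case False
    have g0: "0 < g" using scalar_prod_self_pos[OF w False] by (simp add: g_def)
    let ?u = "(r / g) \<cdot>\<^sub>v w"
    have "?u \<bullet> ?u = r\<^sup>2" using w g0 by (simp add: g(2)[symmetric] power2_eq_square)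
    then have "?u \<in> centered_ball d r" using r w by (simp add: centered_ball_def vec_len_def)
    then have "?u \<in> symmetric_hull d x n" using ball by blast
    then obtain b where b: "(\<Sum>t\<in>{1..n}. \<bar>b t\<bar>) \<le> 1" "?u = Matrix.vec d (\<lambda>i. \<Sum>t\<in>{1..n}. b t * x t $ i)"
      by (rule symmetric_hullE[OF _ x])
    have "r * w $ i = g * (\<Sum>t\<in>{1..n}. b t * x t $ i)" if "i < d" for i
    proof -
      have "r / g * w $ i = (\<Sum>t\<in>{1..n}. b t * x t $ i)"
        using arg_cong[OF b(2), of "\<lambda>v. v $ i"] w that by simp
      then show ?thesis using g0 by (simp add: field_simps)
    qed
    then show ?thesis using that b(1) by blast
  qed
  \<comment> \<open>In the formula for \<open>v\<close>, the term r^2 w is replaced by r g times the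
    combination with coefficients \<open>b\<close>, and everything is divided by \<alpha>.\<close>
  define a where "a = (\<lambda>t. (r * g * b t + c t * y t) / \<alpha>)"
  have "(\<Sum>t\<in>{1..n}. \<bar>a t\<bar>) \<le> (\<Sum>t\<in>{1..n}. (r * g * \<bar>b t\<bar> + c t * \<bar>y t\<bar>) / \<alpha>)"
  proof (rule sum_mono)
    fix t assume "t \<in> {1..n}"
    then have "0 \<le> c t" using c by blast
    then have "\<bar>r * g * b t + c t * y t\<bar> \<le> r * g * \<bar>b t\<bar> + c t * \<bar>y t\<bar>"
      using abs_triangle_ineq[of "r * g * b t" "c t * y t"] r g(1) by (simp add: abs_mult)
    then show "\<bar>a t\<bar> \<le> (r * g * \<bar>b t\<bar> + c t * \<bar>y t\<bar>) / \<alpha>"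
      using \<alpha>(1) by (simp add: a_def abs_divide divide_right_mono)
  qed
  also have "\<dots> = (r * g * (\<Sum>t\<in>{1..n}. \<bar>b t\<bar>) + (\<Sum>t\<in>{1..n}. c t * \<bar>y t\<bar>)) / \<alpha>"
    by (simp add: sum_divide_distrib[symmetric] sum.distrib sum_distrib_left)
  \<comment> \<open>The linear terms r g and |y t| carry the weights 1 and \<open>c t\<close>. After
    splitting, the quadratic parts total at most \<alpha>/2 by \<open>le1\<close>, and the constants
    total (1 + sum of the weights \<open>c t\<close>)/(2\<alpha>) = \<alpha>/2. This balance
    dictates the value of \<alpha>.\<close>
  also have "\<dots> \<le> 1"
  proof -
    have "r * g * (\<Sum>t\<in>{1..n}. \<bar>b t\<bar>) \<le> r * g"
      using mult_left_mono[OF b(1), of "r * g"] r g(1) by simp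
    also have "\<dots> \<le> (\<alpha> * (r * g)\<^sup>2 + 1 / \<alpha>) / 2" by (rule le_mean_of_scaling[OF \<alpha>(1)])
    finally have 1: "r * g * (\<Sum>t\<in>{1..n}. \<bar>b t\<bar>) \<le> (\<alpha> * (r * g)\<^sup>2 + 1 / \<alpha>) / 2" .
    have "(\<Sum>t\<in>{1..n}. c t * \<bar>y t\<bar>) \<le> (\<Sum>t\<in>{1..n}. c t * ((\<alpha> * \<bar>y t\<bar>\<^sup>2 + 1 / \<alpha>) / 2))"
      by (intro sum_mono mult_left_mono le_mean_of_scaling \<alpha>(1)) (use c in blast)
    also have "\<dots> = (\<Sum>t\<in>{1..n}. \<alpha> / 2 * (c t * (y t)\<^sup>2) + 1 / \<alpha> / 2 * c t)"
      by (rule sum.cong) (auto simp: algebra_simps add_divide_distrib)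
    also have "\<dots> = \<alpha> / 2 * (\<Sum>t\<in>{1..n}. c t * (y t)\<^sup>2) + 1 / \<alpha> / 2 * (\<Sum>t\<in>{1..n}. c t)"
      unfolding sum.distrib sum_distrib_left ..
    finally have "r * g * (\<Sum>t\<in>{1..n}. \<bar>b t\<bar>) + (\<Sum>t\<in>{1..n}. c t * \<bar>y t\<bar>)
        \<le> \<alpha> / 2 * ((r * g)\<^sup>2 + (\<Sum>t\<in>{1..n}. c t * (y t)\<^sup>2)) + \<alpha>\<^sup>2 / \<alpha> / 2"
      using 1 unfolding \<alpha>(2) by (simp add: algebra_simps add_divide_distrib)
    also have "\<dots> \<le> \<alpha> / 2 * 1 + \<alpha>\<^sup>2 / \<alpha> / 2"
      using le1 \<alpha>(1) by (intro add_right_mono mult_left_mono) auto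
    also have "\<dots> = \<alpha>" using \<alpha>(1) by (simp add: power2_eq_square)
    finally show ?thesis using \<alpha>(1) by simp
  qed
  finally have a: "(\<Sum>t\<in>{1..n}. \<bar>a t\<bar>) \<le> 1" .
  have "(1 / \<alpha>) \<cdot>\<^sub>v v = Matrix.vec d (\<lambda>i. \<Sum>t\<in>{1..n}. a t * x t $ i)"
  proof (rule eq_vecI)
    fix i assume "i < dim_vec (Matrix.vec d (\<lambda>i. \<Sum>t\<in>{1..n}. a t * x t $ i))"
    then have i: "i < d" by simp
    have "(\<Sum>t\<in>{1..n}. a t * x t $ i)
        = (r * (g * (\<Sum>t\<in>{1..n}. b t * x t $ i)) + (\<Sum>t\<in>{1..n}. c t * y t * x t $ i)) / \<alpha>"
      unfolding a_def sum_distrib_left sum.distrib[symmetric] sum_divide_distrib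
      by (rule sum.cong) (auto simp: algebra_simps add_divide_distrib)
    also have "\<dots> = v $ i / \<alpha>"
      unfolding vi[OF i] b(2)[OF i, symmetric] y_def by (simp add: power2_eq_square mult.assoc)
    finally show "((1 / \<alpha>) \<cdot>\<^sub>v v) $ i = Matrix.vec d (\<lambda>i. \<Sum>t\<in>{1..n}. a t * x t $ i) $ i"
      using i vc by simp
  qed (use vc in simp)
  then show "(1 / \<alpha>) \<cdot>\<^sub>v v \<in> symmetric_hull d x n"
    using symmetric_hullI[OF n x a] by simp
qed

text \<open>At scale 2 R^2 the trace term is at most (d + S)/2, where S is the sum of the
  coefficients, so half of S remains on the left. After doubling, a surplus -d is left over, which
  pays for the summand 1.\<close>

lemma sum_weights_le:
  fixes c q :: "nat \<Rightarrow> real"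
  assumes d: "1 \<le> d" and r: "0 < r" "r \<le> R" and A: "A \<in> carrier_mat d d" "invertible_mat A"
    and c: "\<forall>s\<in>I. 0 \<le> c s" and q: "\<forall>s\<in>I. q s \<le> R\<^sup>2"
    and fro: "fro A = d * r\<^sup>2 + (\<Sum>s\<in>I. c s * q s)"
    and lndet: "d * ln (r\<^sup>2) + (\<Sum>s\<in>I. c s) \<le> ln ((det A)\<^sup>2)"
  shows "1 + (\<Sum>s\<in>I. c s) \<le> 9 * (d * ln (R / r + 1))"
proof -
  let ?S = "\<Sum>s\<in>I. c s"
  have R: "0 < R" using r by simp
  have "(\<Sum>s\<in>I. c s * q s) \<le> (\<Sum>s\<in>I. c s * R\<^sup>2)"
    using c q by (intro sum_mono mult_left_mono) auto
  then have "fro A \<le> d * r\<^sup>2 + ?S * R\<^sup>2" unfolding fro by (simp add: sum_distrib_right)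
  also have "\<dots> \<le> d * R\<^sup>2 + ?S * R\<^sup>2" using r by (intro add_right_mono mult_left_mono power_mono) auto
  finally have "fro A / (2 * R\<^sup>2) \<le> (d + ?S) / 2" using R by (simp add: field_simps)
  moreover have "ln ((det A)\<^sup>2) \<le> d * ln (2 * R\<^sup>2) + fro A / (2 * R\<^sup>2) - d"
    using R by (intro ln_det_sq_le[OF A]) simp
  ultimately have "?S \<le> 2 * (d * (ln (2 * R\<^sup>2) - ln (r\<^sup>2))) - d"
    using lndet by (simp add: algebra_simps)
  also have "ln (2 * R\<^sup>2) - ln (r\<^sup>2) = ln 2 + 2 * ln (R / r)"
    using R r by (simp add: ln_mult ln_div ln_realpow)
  finally have S: "1 + ?S \<le> 2 * (d * (ln 2 + 2 * ln (R / r)))" using d by linarith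
  let ?L = "ln (R / r + 1)"
  \<comment> \<open>The first bound uses r <= R. Together they give the constant 6, which is rounded
    up to the square 9.\<close>
  have "ln 2 \<le> ?L" "ln (R / r) \<le> ?L" using R r by (auto simp: field_simps)
  then have "ln 2 + 2 * ln (R / r) \<le> 3 * ?L" by linarith
  then have "d * (ln 2 + 2 * ln (R / r)) \<le> d * (3 * ?L)" by (intro mult_left_mono) auto
  moreover have "0 \<le> d * ?L" using R r by (intro mult_nonneg_nonneg) auto
  ultimately show ?thesis using S by linarith
qed

theorem theorem9:
  shows "\<exists>C::real. C > 0 \<and>
    (\<forall>(d::nat) (n::nat) (x :: nat \<Rightarrow> real Matrix.vec) (r::real) (R::real).
       d \<ge> 1 \<longrightarrow> n \<ge> 1 \<longrightarrow>
       (\<forall>t\<in>{1..n}. x t \<in> carrier_vec d) \<longrightarrow>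
       r > 0 \<longrightarrow>
       centered_ball d r \<subseteq> symmetric_hull d x n \<longrightarrow>
       R = Max ((\<lambda>t. vec_len (x t)) ` {1..n}) \<longrightarrow>
       (\<exists>\<alpha>::real. \<alpha> > 0 \<and> \<alpha> \<le> C * sqrt (real d * ln (R / r + 1)) \<and>
          (\<lambda>v. (1 / \<alpha>) \<cdot>\<^sub>v v) ` stream_ellipsoid d r x n \<subseteq> symmetric_hull d x n \<and>
          symmetric_hull d x n \<subseteq> stream_ellipsoid d r x n))"
\<comment> \<open>The constant 3 is the square root of the 9 in
  \<open>sum_weights_le\<close>.\<close>
proof (rule exI[of _ 3], intro conjI allI impI)
  fix d n :: nat and x :: "nat \<Rightarrow> real Matrix.vec" and r R :: real
  assume d: "1 \<le> d" and n: "1 \<le> n" and x: "\<forall>t\<in>{1..n}. x t \<in> carrier_vec d" and r: "0 < r"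
    and ball: "centered_ball d r \<subseteq> symmetric_hull d x n"
    and R_def: "R = Max ((\<lambda>t. vec_len (x t)) ` {1..n})"
  have len: "vec_len (x t) \<le> R" if "t \<in> {1..n}" for t
    unfolding R_def using that by (intro Max_ge) auto
  have len_nonneg: "0 \<le> vec_len v" for v
    unfolding vec_len_def by (simp add: scalar_prod_self_nonneg)
  have R0: "0 \<le> R" using len[of 1] len_nonneg[of "x 1"] n by simp
  have xR: "\<forall>t\<in>{1..n}. x t \<bullet> x t \<le> R\<^sup>2"
  proof
    fix t assume "t \<in> {1..n}"
    then have "(vec_len (x t))\<^sup>2 \<le> R\<^sup>2" by (intro power_mono len len_nonneg)
    then show "x t \<bullet> x t \<le> R\<^sup>2" by (simp add: vec_len_def scalar_prod_self_nonneg)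
  qed
  have rR: "r \<le> R" by (rule radius_le_of_ball_subset_hull[OF d n x r ball R0 xR])
  from stream_invariant[OF d r x] obtain A c
    where A: "A \<in> carrier_mat d d" "invertible_mat A" and E: "stream_ellipsoid d r x n = ell d A"
    and c: "\<forall>s\<in>{1..n}. 0 \<le> c s \<and> x s \<in> ell d A"
    and gram: "\<forall>w\<in>carrier_vec d. \<forall>i<d.
      (A * A\<^sup>T *\<^sub>v w) $ i = r\<^sup>2 * w $ i + (\<Sum>s\<in>{1..n}. c s * (x s \<bullet> w) * x s $ i)"
    and fro: "fro A = d * r\<^sup>2 + (\<Sum>s\<in>{1..n}. c s * (x s \<bullet> x s))"
    and lndet: "d * ln (r\<^sup>2) + (\<Sum>s\<in>{1..n}. c s) \<le> ln ((det A)\<^sup>2)"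
    by (elim exE conjE)
  have c0: "\<forall>s\<in>{1..n}. 0 \<le> c s" and xA: "\<forall>s\<in>{1..n}. x s \<in> ell d A" using c by blast+
  define \<alpha> where "\<alpha> = sqrt (1 + (\<Sum>s\<in>{1..n}. c s))"
  have "0 \<le> (\<Sum>s\<in>{1..n}. c s)" using c0 by (intro sum_nonneg) blast
  then have "0 < \<alpha>" by (simp add: \<alpha>_def)
  moreover have "\<alpha> \<le> 3 * sqrt (real d * ln (R / r + 1))"
  proof -
    have "\<alpha> \<le> sqrt (9 * (d * ln (R / r + 1)))"
      unfolding \<alpha>_def by (intro real_sqrt_le_mono sum_weights_le[OF d r rR A c0 xR fro lndet])
    also have "\<dots> = sqrt 9 * sqrt (d * ln (R / r + 1))" by (rule real_sqrt_mult)
    also have "sqrt 9 = (3 :: real)" by (rule real_sqrt_unique) auto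
    finally show ?thesis .
  qed
  moreover have "(\<lambda>v. (1 / \<alpha>) \<cdot>\<^sub>v v) ` stream_ellipsoid d r x n \<subseteq> symmetric_hull d x n"
    unfolding E by (rule scaled_ell_subset_hull[OF n x r ball A c0 gram \<alpha>_def])
  moreover have "symmetric_hull d x n \<subseteq> stream_ellipsoid d r x n"
    unfolding E by (rule symmetric_hull_subset_ell[OF A x xA])
  ultimately show "\<exists>\<alpha>>0. \<alpha> \<le> 3 * sqrt (real d * ln (R / r + 1)) \<and>
      (\<lambda>v. (1 / \<alpha>) \<cdot>\<^sub>v v) ` stream_ellipsoid d r x n \<subseteq> symmetric_hull d x n \<and>
      symmetric_hull d x n \<subseteq> stream_ellipsoid d r x n"
    by blast
qed simp

end
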